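(* Let $L$ be a vocabulary with maximum relation arity $k$. If $M$ is an $L$-structure of order $n$, then $$BS(M)<\left(1-\frac{1}{2k^2+2}\right)n+k.$$ If $k=1$, then moreover $BS(M)\le n/2+1$.
   Context: A vocabulary $L$ is a finite list of relation symbols with positive integer arities; maximum relation arity = largest arity. An $L$-structure $M$ has finite universe $V(M)$ and relations $R^M:V(M)^l\to\{0,1\}$; its order is $|V(M)|$. A Bernays–Schönfinkel formula is a first-order formula (over $L\cup\{=\}$) of the form $\exists y_1\ldots\exists y_p\forall x_1\ldots\forall x_q\,\Psi$ with $p,q\ge0$ and $\Psi$ quantifier-free. A closed formula identifies an $L$-structure $M$ of order $n$ if it is true on $M$ and false on every $L$-structure of order $n$ not isomorphic to $M$. $BS(M)$ denotes the minimum total number of quantifiers $p+q$ in a Bernays–Schönfinkel formula identifying $M$. *)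

theory Defs
  imports Complex_Main
begin

text \<open>A vocabulary is the list of arities of its relation symbols; the symbols themselves are the
  positions \<open>0, \<dots>, length L - 1\<close>.\<close>

definition vocabulary :: "nat list \<Rightarrow> bool" where
  "vocabulary L \<longleftrightarrow> (\<forall>l \<in> set L. 0 < l)"

definition max_arity :: "nat list \<Rightarrow> nat" where
  "max_arity L = Max (set L)"

datatype 'a fo_struct = Struct (universe: "'a set") (rel: "nat \<Rightarrow> 'a list set")

definition fo_structure :: "nat list \<Rightarrow> 'a fo_struct \<Rightarrow> bool" where
  "fo_structure L M \<longleftrightarrow> finite (universe M) \<and>
     (\<forall>i < length L. \<forall>xs \<in> rel M i. length xs = L ! i \<and> set xs \<subseteq> universe M)"

definition order_of :: "'a fo_struct \<Rightarrow> nat" where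
  "order_of M = card (universe M)"

definition isomorphic :: "nat list \<Rightarrow> 'a fo_struct \<Rightarrow> 'b fo_struct \<Rightarrow> bool" where
  "isomorphic L M N \<longleftrightarrow> (\<exists>h. bij_betw h (universe M) (universe N) \<and>
     (\<forall>i < length L. \<forall>xs. length xs = L ! i \<and> set xs \<subseteq> universe M \<longrightarrow>
        (xs \<in> rel M i \<longleftrightarrow> map h xs \<in> rel N i)))"

datatype fm =
    FF
  | Rel nat "nat list"
  | Eq nat nat
  | Neg fm
  | Conj fm fm
  | Disj fm fm
  | Ex nat fm
  | All nat fm

primrec sat :: "'a fo_struct \<Rightarrow> (nat \<Rightarrow> 'a) \<Rightarrow> fm \<Rightarrow> bool" where
  "sat M e FF \<longleftrightarrow> False"
| "sat M e (Rel i vs) \<longleftrightarrow> map e vs \<in> rel M i"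
| "sat M e (Eq u v) \<longleftrightarrow> e u = e v"
| "sat M e (Neg \<phi>) \<longleftrightarrow> \<not> sat M e \<phi>"
| "sat M e (Conj \<phi> \<psi>) \<longleftrightarrow> sat M e \<phi> \<and> sat M e \<psi>"
| "sat M e (Disj \<phi> \<psi>) \<longleftrightarrow> sat M e \<phi> \<or> sat M e \<psi>"
| "sat M e (Ex v \<phi>) \<longleftrightarrow> (\<exists>a \<in> universe M. sat M (e(v := a)) \<phi>)"
| "sat M e (All v \<phi>) \<longleftrightarrow> (\<forall>a \<in> universe M. sat M (e(v := a)) \<phi>)"

primrec fv :: "fm \<Rightarrow> nat set" where
  "fv FF = {}"
| "fv (Rel i vs) = set vs"
| "fv (Eq u v) = {u, v}"
| "fv (Neg \<phi>) = fv \<phi>"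
| "fv (Conj \<phi> \<psi>) = fv \<phi> \<union> fv \<psi>"
| "fv (Disj \<phi> \<psi>) = fv \<phi> \<union> fv \<psi>"
| "fv (Ex v \<phi>) = fv \<phi> - {v}"
| "fv (All v \<phi>) = fv \<phi> - {v}"

primrec wf_fm :: "nat list \<Rightarrow> fm \<Rightarrow> bool" where
  "wf_fm L FF \<longleftrightarrow> True"
| "wf_fm L (Rel i vs) \<longleftrightarrow> i < length L \<and> length vs = L ! i"
| "wf_fm L (Eq u v) \<longleftrightarrow> True"
| "wf_fm L (Neg \<phi>) \<longleftrightarrow> wf_fm L \<phi>"
| "wf_fm L (Conj \<phi> \<psi>) \<longleftrightarrow> wf_fm L \<phi> \<and> wf_fm L \<psi>"
| "wf_fm L (Disj \<phi> \<psi>) \<longleftrightarrow> wf_fm L \<phi> \<and> wf_fm L \<psi>"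
| "wf_fm L (Ex v \<phi>) \<longleftrightarrow> wf_fm L \<phi>"
| "wf_fm L (All v \<phi>) \<longleftrightarrow> wf_fm L \<phi>"

primrec quantifiers :: "fm \<Rightarrow> nat" where
  "quantifiers FF = 0"
| "quantifiers (Rel i vs) = 0"
| "quantifiers (Eq u v) = 0"
| "quantifiers (Neg \<phi>) = quantifiers \<phi>"
| "quantifiers (Conj \<phi> \<psi>) = quantifiers \<phi> + quantifiers \<psi>"
| "quantifiers (Disj \<phi> \<psi>) = quantifiers \<phi> + quantifiers \<psi>"
| "quantifiers (Ex v \<phi>) = Suc (quantifiers \<phi>)"
| "quantifiers (All v \<phi>) = Suc (quantifiers \<phi>)"

definition closed_fm :: "nat list \<Rightarrow> fm \<Rightarrow> bool" where
  "closed_fm L \<phi> \<longleftrightarrow> wf_fm L \<phi> \<and> fv \<phi> = {}"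

definition bernays_schoenfinkel :: "fm \<Rightarrow> bool" where
  "bernays_schoenfinkel \<phi> \<longleftrightarrow>
     (\<exists>ys xs \<psi>. \<phi> = foldr Ex ys (foldr All xs \<psi>) \<and> quantifiers \<psi> = 0)"

text \<open>For a closed formula the assignment is irrelevant.\<close>

definition true_on :: "'a fo_struct \<Rightarrow> fm \<Rightarrow> bool" where
  "true_on M \<phi> \<longleftrightarrow> (\<forall>e. sat M e \<phi>)"

text \<open>Letting \<open>N\<close> range over the type of \<open>M\<close> loses nothing: every structure of the same order,
  over whatever type, is isomorphic to one with universe \<open>universe M\<close>.\<close>

definition identifies :: "nat list \<Rightarrow> fm \<Rightarrow> 'a fo_struct \<Rightarrow> bool" where
  "identifies L \<phi> M \<longleftrightarrow> closed_fm L \<phi> \<and> true_on M \<phi> \<and>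
     (\<forall>N :: 'a fo_struct. fo_structure L N \<and> order_of N = order_of M \<and> \<not> isomorphic L M N \<longrightarrow>
        \<not> true_on N \<phi>)"

definition BS :: "nat list \<Rightarrow> 'a fo_struct \<Rightarrow> nat" where
  "BS L M = (LEAST m. \<exists>\<phi>. bernays_schoenfinkel \<phi> \<and> identifies L \<phi> M \<and> quantifiers \<phi> = m)"

lemma sat_cong: "(\<And>v. v \<in> fv \<phi> \<Longrightarrow> e v = e' v) \<Longrightarrow> sat M e \<phi> \<longleftrightarrow> sat M e' \<phi>"
proof (induction \<phi> arbitrary: e e')
  case (Rel i vs)
  then have "map e vs = map e' vs" by simp
  then show ?case by (simp only: sat.simps)
next
  case (Conj \<phi> \<psi>)
  have "sat M e \<phi> = sat M e' \<phi>" "sat M e \<psi> = sat M e' \<psi>"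
    using Conj.prems by (auto intro!: Conj.IH)
  then show ?case by simp
next
  case (Disj \<phi> \<psi>)
  have "sat M e \<phi> = sat M e' \<phi>" "sat M e \<psi> = sat M e' \<psi>"
    using Disj.prems by (auto intro!: Disj.IH)
  then show ?case by simp
next
  case (Neg \<phi>)
  have "sat M e \<phi> = sat M e' \<phi>"
    using Neg.prems by (auto intro!: Neg.IH)
  then show ?case by simp
next
  case (Ex v \<phi>)
  have "sat M (e(v := a)) \<phi> = sat M (e'(v := a)) \<phi>" for a
    using Ex.prems by (auto intro!: Ex.IH)
  then show ?case by simp
next
  case (All v \<phi>)
  have "sat M (e(v := a)) \<phi> = sat M (e'(v := a)) \<phi>" for a
    using All.prems by (auto intro!: All.IH)
  then show ?case by simp
qed simp_all

lemma true_on_closed: "fv \<phi> = {} \<Longrightarrow> true_on M \<phi> \<longleftrightarrow> sat M e \<phi>"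
  unfolding true_on_def using sat_cong[of \<phi>] by blast

lemma sat_foldr_Ex:
  "sat M e (foldr Ex ys \<phi>) \<longleftrightarrow>
     (\<exists>e'. (\<forall>v \<in> set ys. e' v \<in> universe M) \<and> (\<forall>v. v \<notin> set ys \<longrightarrow> e' v = e v) \<and> sat M e' \<phi>)"
proof (induction ys arbitrary: e)
  case Nil
  have "e' = e" if "\<forall>v. e' v = e v" for e' using that by blast
  then show ?case by auto
next
  case (Cons y ys)
  show ?case (is "?l = ?r")
  proof
    assume ?l
    then obtain a e' where a: "a \<in> universe M" "\<forall>v \<in> set ys. e' v \<in> universe M"
      "\<forall>v. v \<notin> set ys \<longrightarrow> e' v = (e(y := a)) v" "sat M e' \<phi>"
      using Cons.IH by auto
    then have "e' y \<in> universe M" by (cases "y \<in> set ys") auto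
    with a show ?r by (intro exI[of _ e']) auto
  next
    assume ?r
    then obtain e' where e': "\<forall>v \<in> set (y # ys). e' v \<in> universe M"
      "\<forall>v. v \<notin> set (y # ys) \<longrightarrow> e' v = e v" "sat M e' \<phi>" by blast
    have "sat M (e(y := e' y)) (foldr Ex ys \<phi>)"
      unfolding Cons.IH using e' by (intro exI[of _ e']) auto
    with e'(1) show ?l by auto
  qed
qed

lemma fv_foldr_Ex: "fv (foldr Ex ys \<phi>) = fv \<phi> - set ys"
  by (induction ys) auto

lemma wf_fm_foldr_Ex: "wf_fm L (foldr Ex ys \<phi>) \<longleftrightarrow> wf_fm L \<phi>"
  by (induction ys) auto

lemma ex_conjunction:
  assumes "finite F" "\<forall>\<phi> \<in> F. wf_fm L \<phi> \<and> fv \<phi> \<subseteq> X \<and> quantifiers \<phi> = 0"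
  shows "\<exists>\<psi>. wf_fm L \<psi> \<and> fv \<psi> \<subseteq> X \<and> quantifiers \<psi> = 0 \<and>
    (\<forall>(M :: 'a fo_struct) e. sat M e \<psi> \<longleftrightarrow> (\<forall>\<phi> \<in> F. sat M e \<phi>))"
  using assms
proof (induction F rule: finite_induct)
  case empty
  show ?case by (intro exI[of _ "Neg FF"]) simp
next
  case (insert \<phi> F)
  then obtain \<psi> where "wf_fm L \<psi> \<and> fv \<psi> \<subseteq> X \<and> quantifiers \<psi> = 0 \<and>
    (\<forall>(M :: 'a fo_struct) e. sat M e \<psi> \<longleftrightarrow> (\<forall>\<phi> \<in> F. sat M e \<phi>))" by auto
  with insert.prems show ?case by (intro exI[of _ "Conj \<phi> \<psi>"]) auto
qed

text \<open>The minimum defining \<open>BS\<close> is taken over a nonempty set.\<close>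

lemma ex_identifying:
  fixes M :: "'a fo_struct"
  assumes "fo_structure L M"
  shows "\<exists>\<phi>. bernays_schoenfinkel \<phi> \<and> identifies L \<phi> M"
proof -
  define n where "n = order_of M"
  have fin: "finite (universe M)" using assms by (simp add: fo_structure_def)
  obtain f where f: "bij_betw f {..<n} (universe M)"
    using ex_bij_betw_nat_finite[OF fin] by (auto simp: n_def order_of_def atLeast0LessThan)
  define A where "A = (\<lambda>(u, v). Eq u v) ` ({..<n} \<times> {..<n}) \<union>
    (\<Union>i < length L. Rel i ` {vs. set vs \<subseteq> {..<n} \<and> length vs = L ! i})"
  define F where "F = {\<phi> \<in> A \<union> Neg ` A. sat M f \<phi>}"
  have "finite A" unfolding A_def by (auto intro!: finite_lists_length_eq)
  then have "finite F" unfolding F_def by auto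
  moreover have "\<forall>\<phi> \<in> F. wf_fm L \<phi> \<and> fv \<phi> \<subseteq> {..<n} \<and> quantifiers \<phi> = 0"
    unfolding F_def A_def by auto
  ultimately obtain \<psi> where \<psi>: "wf_fm L \<psi>" "fv \<psi> \<subseteq> {..<n}" "quantifiers \<psi> = 0"
    and sat\<psi>: "\<And>(N :: 'a fo_struct) e. sat N e \<psi> \<longleftrightarrow> (\<forall>\<phi> \<in> F. sat N e \<phi>)"
    using ex_conjunction[of F L "{..<n}"] by blast
  define \<theta> where "\<theta> = foldr Ex [0..<n] \<psi>"
  have closed: "closed_fm L \<theta>"
    using \<psi> by (auto simp: closed_fm_def \<theta>_def fv_foldr_Ex wf_fm_foldr_Ex)
  then have fv: "fv \<theta> = {}" by (simp add: closed_fm_def)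
  have "sat M f \<theta>"
    unfolding \<theta>_def sat_foldr_Ex
    using bij_betwE[OF f] by (intro exI[of _ f]) (auto simp: sat\<psi> F_def)
  then have "true_on M \<theta>" using true_on_closed[OF fv] by blast
  moreover have "isomorphic L M N"
    if N: "fo_structure L N" "order_of N = order_of M" "true_on N \<theta>" for N :: "'a fo_struct"
  proof -
    obtain e where e: "\<And>v. v < n \<Longrightarrow> e v \<in> universe N" and "sat N e \<psi>"
      using N(3) unfolding true_on_def \<theta>_def sat_foldr_Ex set_upt atLeast0LessThan
      by (meson lessThan_iff)
    then have F: "sat N e \<phi>" if "\<phi> \<in> F" for \<phi> using that sat\<psi> by blast
    have A: "sat N e \<phi> \<longleftrightarrow> sat M f \<phi>" if "\<phi> \<in> A" for \<phi>
      using F[of \<phi>] F[of "Neg \<phi>"] that by (auto simp: F_def)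
    have "inj_on e {..<n}"
    proof (rule inj_onI)
      fix u v assume uv: "u \<in> {..<n}" "v \<in> {..<n}" "e u = e v"
      then have "Eq u v \<in> A" unfolding A_def by auto
      from A[OF this] uv have "f u = f v" by simp
      with uv f show "u = v" by (meson bij_betw_def inj_onD)
    qed
    moreover have "e ` {..<n} = universe N"
    proof (rule card_subset_eq)
      show "finite (universe N)" using N(1) by (simp add: fo_structure_def)
      show "e ` {..<n} \<subseteq> universe N" using e by auto
      show "card (e ` {..<n}) = card (universe N)"
        using card_image[OF \<open>inj_on e {..<n}\<close>] N(2) by (simp add: n_def order_of_def)
    qed
    ultimately have eb: "bij_betw e {..<n} (universe N)" by (simp add: bij_betw_def)
    let ?g = "inv_into {..<n} f"
    have g: "bij_betw ?g (universe M) {..<n}" by (rule bij_betw_inv_into[OF f])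
    have "xs \<in> rel M i \<longleftrightarrow> map (e \<circ> ?g) xs \<in> rel N i"
      if "i < length L" "length xs = L ! i" "set xs \<subseteq> universe M" for i xs
    proof -
      have "set (map ?g xs) \<subseteq> {..<n}" using that(3) bij_betwE[OF g] by auto
      then have "Rel i (map ?g xs) \<in> A" using that unfolding A_def
        by (intro UnI2 UN_I[of i] imageI) auto
      from A[OF this] have "map e (map ?g xs) \<in> rel N i \<longleftrightarrow> map f (map ?g xs) \<in> rel M i"
        by (simp only: sat.simps)
      moreover have "map f (map ?g xs) = xs"
        using that(3) bij_betw_inv_into_right[OF f] by (auto intro!: map_idI)
      ultimately show ?thesis by simp
    qed
    then show ?thesis
      unfolding isomorphic_def using bij_betw_trans[OF g eb]
      by (intro exI[of _ "e \<circ> ?g"]) blast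
  qed
  moreover have "bernays_schoenfinkel \<theta>"
    unfolding bernays_schoenfinkel_def \<theta>_def
    by (intro exI[of _ "[0..<n]"] exI[of _ "[]"] exI[of _ \<psi>]) (simp add: \<psi>(3))
  ultimately show ?thesis using closed unfolding identifies_def by blast
qed

end

theory Submission
  imports Defs "HOL-Combinatorics.Transposition" "HOL-Library.Disjoint_Sets"
begin

text \<open>
  Call two elements similar if swapping them is an automorphism of \<open>M\<close>, and call a set \<open>B\<close> a base
  if any two elements outside \<open>B\<close> with the same quantifier-free type over \<open>B\<close> are similar. Given a
  base \<open>B\<close>, guess a copy of \<open>B\<close> existentially and let \<open>q \<ge> k\<close> universal quantifiers say that every
  \<open>q\<close>-tuple looks over this copy like some \<open>q\<close>-tuple of \<open>M\<close> over \<open>B\<close>. This identifies \<open>M\<close> as soon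
  as \<open>q\<close> exceeds the sizes of all type classes outside \<open>B\<close> (their sizes are then bounded from above,
  hence correct by counting), or there is only one class.

  Let \<open>m\<close> be the largest number of type classes over any set. Deleting from the universe one element
  of each of \<open>m\<close> classes leaves a base with singleton classes, which costs \<open>n - m + k\<close>. There
  is also a base \<open>B\<close> with at most \<open>(k\<^sup>2 - 1) m\<close> elements. It arises in \<open>k - 1\<close> stages: for
  \<open>r = k - 1, \<dots>, 1\<close>, enlarge the current set to an \<open>X\<close> over which no further \<open>r\<close> elements increase
  the number of classes, then add all classes with at most \<open>r + 1\<close> elements. A tuple that
  witnesses the dissimilarity of two elements of the same type must meet every stage, and it is too
  short for that. If \<open>s\<close> is the size of the largest class \<open>K\<close> over \<open>B\<close>, then \<open>B\<close> costs
  \<open>|B| + max k (s + 1)\<close>, and the complement of \<open>K\<close> costs \<open>n - s + k\<close>. One of the three bounds is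
  always good enough.
\<close>

section \<open>Maps between finite sets\<close>

lemma ex_image_superset:
  assumes "S \<subseteq> U" "U \<noteq> {}" "finite S" "finite I" "card S \<le> card I"
  shows "\<exists>f. S \<subseteq> f ` I \<and> f ` I \<subseteq> U"
proof (cases "S = {}")
  case True
  then show ?thesis
    using assms(2) by (intro exI[of _ "\<lambda>_. SOME u. u \<in> U"]) (auto simp: some_in_eq)
next
  case False
  then obtain f where "f ` I = S"
    using assms inj_on_iff_surj[OF False, of I] inj_on_iff_card_le[of S I] by auto
  with assms(1) show ?thesis by (intro exI[of _ f]) simp
qed

lemma card_fibres_eq_if_le:
  assumes fin: "finite A" "finite B" and card: "card A = card B"
    and le: "\<And>t. card {b \<in> B. \<beta> b = t} \<le> card {a \<in> A. \<alpha> a = t}"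
  shows "card {b \<in> B. \<beta> b = t} = card {a \<in> A. \<alpha> a = t}"
proof (cases "t \<in> \<alpha> ` A \<union> \<beta> ` B")
  case True
  let ?T = "\<alpha> ` A \<union> \<beta> ` B"
  have "card A = (\<Sum>t\<in>?T. card {a \<in> A. \<alpha> a = t})" "card B = (\<Sum>t\<in>?T. card {b \<in> B. \<beta> b = t})"
    using fin sum.group[of A ?T \<alpha> "\<lambda>_. 1::nat"] sum.group[of B ?T \<beta> "\<lambda>_. 1::nat"] by auto
  then show ?thesis
    using sum_mono_inv[of "\<lambda>t. card {b \<in> B. \<beta> b = t}" ?T "\<lambda>t. card {a \<in> A. \<alpha> a = t}" t]
      True card le fin by auto
next
  case False
  then have "{b \<in> B. \<beta> b = t} = {}" "{a \<in> A. \<alpha> a = t} = {}" by auto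
  then show ?thesis by (metis card.empty)
qed

lemma ex_bij_betw_if_card_fibres_eq:
  assumes fin: "finite A" "finite B"
    and card: "\<And>t. card {b \<in> B. \<beta> b = t} = card {a \<in> A. \<alpha> a = t}"
  shows "\<exists>f. bij_betw f A B \<and> (\<forall>a \<in> A. \<beta> (f a) = \<alpha> a)"
proof -
  have "\<exists>h. bij_betw h {a \<in> A. \<alpha> a = t} {b \<in> B. \<beta> b = t}" for t
    using fin card by (intro finite_same_card_bij) auto
  then obtain h where h: "\<And>t. bij_betw (h t) {a \<in> A. \<alpha> a = t} {b \<in> B. \<beta> b = t}" by metis
  define f where "f a = h (\<alpha> a) a" for a
  have f: "bij_betw f {a \<in> A. \<alpha> a = t} {b \<in> B. \<beta> b = t}" for t
    using h[of t] by (rule bij_betw_cong[THEN iffD1, rotated]) (simp add: f_def)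
  have "bij_betw f (\<Union>t. {a \<in> A. \<alpha> a = t}) (\<Union>t. {b \<in> B. \<beta> b = t})"
    using f by (intro bij_betw_UNION_disjoint) (auto simp: disjoint_family_on_def)
  moreover have "(\<Union>t. {a \<in> A. \<alpha> a = t}) = A" "(\<Union>t. {b \<in> B. \<beta> b = t}) = B" by auto
  moreover have "\<beta> (f a) = \<alpha> a" if "a \<in> A" for a
    using bij_betwE[OF f[of "\<alpha> a"]] that by auto
  ultimately show ?thesis by auto
qed

section \<open>Quantifier-free and prenex formulas\<close>

lemma sat_foldr_All:
  "sat M e (foldr All xs \<phi>) \<longleftrightarrow>
     (\<forall>e'. (\<forall>v \<in> set xs. e' v \<in> universe M) \<and> (\<forall>v. v \<notin> set xs \<longrightarrow> e' v = e v) \<longrightarrow> sat M e' \<phi>)"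
proof -
  have dual: "sat M e (foldr All xs \<phi>) \<longleftrightarrow> \<not> sat M e (foldr Ex xs (Neg \<phi>))" for e
    by (induction xs arbitrary: e) auto
  show ?thesis unfolding dual sat_foldr_Ex by auto
qed

lemma fv_foldr_All: "fv (foldr All xs \<phi>) = fv \<phi> - set xs"
  by (induction xs) auto

lemma wf_fm_foldr_All: "wf_fm L (foldr All xs \<phi>) \<longleftrightarrow> wf_fm L \<phi>"
  by (induction xs) auto

lemma quantifiers_foldr_Ex: "quantifiers (foldr Ex ys \<phi>) = length ys + quantifiers \<phi>"
  by (induction ys) auto

lemma quantifiers_foldr_All: "quantifiers (foldr All xs \<phi>) = length xs + quantifiers \<phi>"
  by (induction xs) auto

lemma true_on_Ex_All:
  fixes M :: "'a fo_struct"
  assumes "fv \<psi> \<subseteq> {..<p + q}"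
  shows "true_on M (foldr Ex [0..<p] (foldr All [p..<p + q] \<psi>)) \<longleftrightarrow>
    (\<exists>e. e ` {..<p} \<subseteq> universe M \<and>
      (\<forall>e'. e' ` {..<p + q} \<subseteq> universe M \<and> (\<forall>i<p. e' i = e i) \<longrightarrow> sat M e' \<psi>))"
    (is "true_on M ?\<theta> \<longleftrightarrow> ?R")
proof -
  have fv: "fv ?\<theta> = {}" using assms by (auto simp: fv_foldr_Ex fv_foldr_All)
  show ?thesis
  proof
    assume "true_on M ?\<theta>"
    then have "sat M undefined ?\<theta>" by (simp add: true_on_def)
    then obtain e where e: "\<forall>v \<in> {0..<p}. e v \<in> universe M"
      and sat: "\<forall>e'. (\<forall>v \<in> {p..<p + q}. e' v \<in> universe M) \<and>
        (\<forall>v. v \<notin> {p..<p + q} \<longrightarrow> e' v = e v) \<longrightarrow> sat M e' \<psi>"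
      unfolding sat_foldr_Ex sat_foldr_All set_upt by (elim exE conjE) (rule that)
    have "sat M e' \<psi>" if e': "e' ` {..<p + q} \<subseteq> universe M" "\<forall>i<p. e' i = e i" for e'
    proof -
      have "sat M (\<lambda>v. if v < p + q then e' v else e v) \<psi>"
        using e' by (intro sat[rule_format]) auto
      moreover have "sat M (\<lambda>v. if v < p + q then e' v else e v) \<psi> \<longleftrightarrow> sat M e' \<psi>"
        using assms by (intro sat_cong) auto
      ultimately show ?thesis by simp
    qed
    with e show ?R by (intro exI[of _ e]) auto
  next
    assume ?R
    then obtain e where e: "e ` {..<p} \<subseteq> universe M"
      and sat: "\<forall>e'. e' ` {..<p + q} \<subseteq> universe M \<and> (\<forall>i<p. e' i = e i) \<longrightarrow> sat M e' \<psi>"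
      by (elim exE conjE) (rule that)
    have "sat M e ?\<theta>"
      unfolding sat_foldr_Ex sat_foldr_All set_upt
    proof (intro exI[of _ e] conjI allI impI; (elim conjE)?)
      fix e'
      assume e': "\<forall>v \<in> {p..<p + q}. e' v \<in> universe M" "\<forall>v. v \<notin> {p..<p + q} \<longrightarrow> e' v = e v"
      then have "e' v \<in> universe M" if "v < p + q" for v
        using e that by (cases "v < p") auto
      with e' show "sat M e' \<psi>" by (intro sat[rule_format]) auto
    qed (use e in auto)
    then show "true_on M ?\<theta>" using true_on_closed[OF fv] by blast
  qed
qed

definition qf_fm :: "nat list \<Rightarrow> nat set \<Rightarrow> fm \<Rightarrow> bool" where
  "qf_fm L X \<phi> \<longleftrightarrow> wf_fm L \<phi> \<and> fv \<phi> \<subseteq> X \<and> quantifiers \<phi> = 0"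

lemma qf_fm_Neg [simp]: "qf_fm L X (Neg \<phi>) \<longleftrightarrow> qf_fm L X \<phi>"
  by (simp add: qf_fm_def)

definition atoms :: "nat list \<Rightarrow> nat set \<Rightarrow> fm set" where
  "atoms L X = (\<lambda>(u, v). Eq u v) ` (X \<times> X) \<union>
     (\<Union>i < length L. Rel i ` {vs. set vs \<subseteq> X \<and> length vs = L ! i})"

lemma finite_atoms: "finite X \<Longrightarrow> finite (atoms L X)"
  unfolding atoms_def by (auto intro!: finite_lists_length_eq)

lemma ball_atoms_iff:
  "(\<forall>\<phi> \<in> atoms L X. P \<phi>) \<longleftrightarrow> (\<forall>u \<in> X. \<forall>v \<in> X. P (Eq u v)) \<and>
     (\<forall>i < length L. \<forall>vs. length vs = L ! i \<and> set vs \<subseteq> X \<longrightarrow> P (Rel i vs))"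
  by (auto simp: atoms_def)

lemma qf_fm_atoms: "\<phi> \<in> atoms L X \<Longrightarrow> qf_fm L X \<phi>"
  unfolding atoms_def qf_fm_def by auto

lemma ex_qf_fm_conjunction:
  assumes "finite F" "\<forall>\<phi> \<in> F. qf_fm L X \<phi>"
  shows "\<exists>\<psi>. qf_fm L X \<psi> \<and> (\<forall>(M :: 'a fo_struct) e. sat M e \<psi> \<longleftrightarrow> (\<forall>\<phi> \<in> F. sat M e \<phi>))"
  using assms unfolding qf_fm_def conj_assoc by (rule ex_conjunction)

lemma ex_qf_fm_truth_set_eq:
  assumes A: "finite A" "\<forall>\<phi> \<in> A. qf_fm L X \<phi>" and T: "T \<subseteq> A"
  shows "\<exists>\<psi>. qf_fm L X \<psi> \<and> (\<forall>(M :: 'a fo_struct) e. sat M e \<psi> \<longleftrightarrow> {\<phi> \<in> A. sat M e \<phi>} = T)"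
proof -
  have fin: "finite (T \<union> Neg ` (A - T))" using A(1) T finite_subset by auto
  have qf: "\<forall>\<phi> \<in> T \<union> Neg ` (A - T). qf_fm L X \<phi>" using A(2) T by auto
  obtain \<psi> where "qf_fm L X \<psi>"
    and \<psi>: "\<And>(M :: 'a fo_struct) e. sat M e \<psi> \<longleftrightarrow> (\<forall>\<phi> \<in> T \<union> Neg ` (A - T). sat M e \<phi>)"
    using ex_qf_fm_conjunction[OF fin qf, where 'a = 'a] by blast
  moreover have "sat M e \<psi> \<longleftrightarrow> {\<phi> \<in> A. sat M e \<phi>} = T" for M :: "'a fo_struct" and e
  proof -
    have "sat M e \<psi> \<longleftrightarrow> (\<forall>\<phi> \<in> T. sat M e \<phi>) \<and> (\<forall>\<phi> \<in> A - T. \<not> sat M e \<phi>)"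
      unfolding \<psi> ball_Un ball_simps by simp
    then show ?thesis using T by auto
  qed
  ultimately show ?thesis by blast
qed

lemma ex_qf_fm_truth_set_in:
  assumes A: "finite A" "\<forall>\<phi> \<in> A. qf_fm L X \<phi>"
  shows "\<exists>\<psi>. qf_fm L X \<psi> \<and> (\<forall>(M :: 'a fo_struct) e. sat M e \<psi> \<longleftrightarrow> {\<phi> \<in> A. sat M e \<phi>} \<in> TT)"
proof -
  obtain d where d: "\<And>T. T \<subseteq> A \<Longrightarrow> qf_fm L X (d T) \<and>
      (\<forall>(M :: 'a fo_struct) e. sat M e (d T) \<longleftrightarrow> {\<phi> \<in> A. sat M e \<phi>} = T)"
    using ex_qf_fm_truth_set_eq[OF A, where 'a = 'a] by metis
  let ?D = "(\<lambda>T. Neg (d T)) ` (TT \<inter> Pow A)"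
  have fin: "finite ?D" using A(1) by simp
  have qf: "\<forall>\<phi> \<in> ?D. qf_fm L X \<phi>" using d by auto
  obtain \<psi> where "qf_fm L X \<psi>"
    and \<psi>: "\<And>(M :: 'a fo_struct) e. sat M e \<psi> \<longleftrightarrow> (\<forall>\<phi> \<in> ?D. sat M e \<phi>)"
    using ex_qf_fm_conjunction[OF fin qf, where 'a = 'a] by blast
  moreover have "sat M e (Neg \<psi>) \<longleftrightarrow> {\<phi> \<in> A. sat M e \<phi>} \<in> TT" for M :: "'a fo_struct" and e
    using d \<psi> by auto
  ultimately show ?thesis by (intro exI[of _ "Neg \<psi>"]) simp
qed

section \<open>Embeddings\<close>

definition strong_hom_on ::
  "nat list \<Rightarrow> 'a fo_struct \<Rightarrow> 'b fo_struct \<Rightarrow> 'a set \<Rightarrow> ('a \<Rightarrow> 'b) \<Rightarrow> bool" where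
  "strong_hom_on L M N D h \<longleftrightarrow> (\<forall>i < length L. \<forall>w. length w = L ! i \<and> set w \<subseteq> D \<longrightarrow>
     (w \<in> rel M i \<longleftrightarrow> map h w \<in> rel N i))"

definition embedding_on ::
  "nat list \<Rightarrow> 'a fo_struct \<Rightarrow> 'b fo_struct \<Rightarrow> 'a set \<Rightarrow> ('a \<Rightarrow> 'b) \<Rightarrow> bool" where
  "embedding_on L M N D h \<longleftrightarrow> inj_on h D \<and> h ` D \<subseteq> universe N \<and> strong_hom_on L M N D h"

lemma strong_hom_onD:
  "strong_hom_on L M N D h \<Longrightarrow> i < length L \<Longrightarrow> length w = L ! i \<Longrightarrow> set w \<subseteq> D \<Longrightarrow>
     w \<in> rel M i \<longleftrightarrow> map h w \<in> rel N i"
  by (simp add: strong_hom_on_def)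

lemma strong_hom_on_subset: "strong_hom_on L M N D h \<Longrightarrow> C \<subseteq> D \<Longrightarrow> strong_hom_on L M N C h"
  unfolding strong_hom_on_def by blast

lemma strong_hom_on_cong:
  assumes "\<And>x. x \<in> D \<Longrightarrow> g x = h x"
  shows "strong_hom_on L M N D g \<longleftrightarrow> strong_hom_on L M N D h"
proof -
  have "map g w = map h w" if "set w \<subseteq> D" for w using that assms by auto
  then show ?thesis unfolding strong_hom_on_def by metis
qed

lemma strong_hom_on_id: "strong_hom_on L M M D id"
  by (simp add: strong_hom_on_def)

lemma strong_hom_on_comp:
  assumes "strong_hom_on L M N D g" "strong_hom_on L N P E h" "g ` D \<subseteq> E"
  shows "strong_hom_on L M P D (h \<circ> g)"
  unfolding strong_hom_on_def
proof (intro allI impI)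
  fix i w assume "i < length L" "length w = L ! i \<and> set w \<subseteq> D"
  then show "w \<in> rel M i \<longleftrightarrow> map (h \<circ> g) w \<in> rel P i"
    using strong_hom_onD[OF assms(1), of i w] strong_hom_onD[OF assms(2), of i "map g w"] assms(3)
    by auto
qed

lemma embedding_on_subset: "embedding_on L M N D h \<Longrightarrow> C \<subseteq> D \<Longrightarrow> embedding_on L M N C h"
  unfolding embedding_on_def by (meson image_mono inj_on_subset order_trans strong_hom_on_subset)

lemma isomorphic_iff_strong_hom_on:
  "isomorphic L M N \<longleftrightarrow>
     (\<exists>h. bij_betw h (universe M) (universe N) \<and> strong_hom_on L M N (universe M) h)"
  by (simp add: isomorphic_def strong_hom_on_def)

lemma ex_embedding_on_if_atoms_agree:
  assumes e': "e' ` X \<subseteq> universe N" and agree: "\<forall>\<phi> \<in> atoms L X. sat M e \<phi> \<longleftrightarrow> sat N e' \<phi>"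
  shows "\<exists>h. embedding_on L M N (e ` X) h \<and> (\<forall>v \<in> X. h (e v) = e' v)"
proof -
  have eq: "e u = e v \<longleftrightarrow> e' u = e' v" if "u \<in> X" "v \<in> X" for u v
    using agree that by (simp add: ball_atoms_iff)
  have rel: "map e vs \<in> rel M i \<longleftrightarrow> map e' vs \<in> rel N i"
    if "i < length L" "length vs = L ! i" "set vs \<subseteq> X" for i vs
    using agree that by (simp add: ball_atoms_iff)
  let ?g = "inv_into X e"
  let ?h = "e' \<circ> ?g"
  have h: "?h (e v) = e' v" if "v \<in> X" for v
    using eq[of "?g (e v)" v] that by (simp add: inv_into_into f_inv_into_f)
  have "w \<in> rel M i \<longleftrightarrow> map ?h w \<in> rel N i"
    if w: "i < length L" "length w = L ! i" "set w \<subseteq> e ` X" for i w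
  proof -
    have "set (map ?g w) \<subseteq> X" using w(3) by (auto intro: inv_into_into)
    moreover have "map e (map ?g w) = w"
      using w(3) by (auto simp: f_inv_into_f subset_iff intro!: map_idI)
    ultimately show ?thesis using rel[of i "map ?g w"] w by simp
  qed
  then have "strong_hom_on L M N (e ` X) ?h" by (simp add: strong_hom_on_def)
  moreover have "inj_on ?h (e ` X)" unfolding inj_on_def using h eq by (metis imageE)
  moreover have "?h ` e ` X \<subseteq> universe N" using h e' by auto
  ultimately show ?thesis using h unfolding embedding_on_def by blast
qed

lemma embedding_on_atoms_agree:
  assumes h: "embedding_on L M N (e ` X) h"
  shows "\<forall>\<phi> \<in> atoms L X. sat M e \<phi> \<longleftrightarrow> sat N (h \<circ> e) \<phi>"
proof -
  have "map e vs \<in> rel M i \<longleftrightarrow> map (h \<circ> e) vs \<in> rel N i"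
    if "i < length L" "length vs = L ! i" "set vs \<subseteq> X" for i vs
  proof -
    have "set (map e vs) \<subseteq> e ` X" using that(3) by auto
    then show ?thesis
      using h that strong_hom_onD[of L M N "e ` X" h i "map e vs"] by (simp add: embedding_on_def)
  qed
  moreover have "e u = e v \<longleftrightarrow> h (e u) = h (e v)" if "u \<in> X" "v \<in> X" for u v
    using h that inj_on_eq_iff[of h "e ` X" "e u" "e v"] by (simp add: embedding_on_def)
  ultimately show ?thesis by (simp add: ball_atoms_iff)
qed

lemma ex_qf_fm_embedding:
  fixes M :: "'a fo_struct"
  assumes X: "finite X" and Y: "Y \<subseteq> X"
  shows "\<exists>\<psi>. qf_fm L X \<psi> \<and> (\<forall>(N :: 'b fo_struct) e. sat N e \<psi> \<longleftrightarrow>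
    (\<exists>h. embedding_on L N M (e ` X) h \<and> (\<forall>v \<in> Y. h (e v) = x v)))"
proof -
  define Ext where "Ext = {e'. e' ` X \<subseteq> universe M \<and> (\<forall>v \<in> Y. e' v = x v)}"
  have qf: "\<forall>\<phi> \<in> atoms L X. qf_fm L X \<phi>" by (simp add: qf_fm_atoms)
  obtain \<psi> where "qf_fm L X \<psi>" and \<psi>: "\<And>(N :: 'b fo_struct) e. sat N e \<psi> \<longleftrightarrow>
      {\<phi> \<in> atoms L X. sat N e \<phi>} \<in> (\<lambda>e'. {\<phi> \<in> atoms L X. sat M e' \<phi>}) ` Ext"
    using ex_qf_fm_truth_set_in[OF finite_atoms[OF X] qf, where 'a = 'b
        and TT = "(\<lambda>e'. {\<phi> \<in> atoms L X. sat M e' \<phi>}) ` Ext"] by blast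
  moreover have "sat N e \<psi> \<longleftrightarrow> (\<exists>h. embedding_on L N M (e ` X) h \<and> (\<forall>v \<in> Y. h (e v) = x v))"
    for N :: "'b fo_struct" and e
  proof -
    have "sat N e \<psi> \<longleftrightarrow> (\<exists>e' \<in> Ext. \<forall>\<phi> \<in> atoms L X. sat N e \<phi> \<longleftrightarrow> sat M e' \<phi>)"
      unfolding \<psi> image_iff by (intro bex_cong refl) auto
    also have "\<dots> \<longleftrightarrow> (\<exists>h. embedding_on L N M (e ` X) h \<and> (\<forall>v \<in> Y. h (e v) = x v))"
    proof (intro iffI; elim bexE exE conjE)
      fix e' assume e': "e' \<in> Ext" and "\<forall>\<phi> \<in> atoms L X. sat N e \<phi> \<longleftrightarrow> sat M e' \<phi>"
      then obtain h where "embedding_on L N M (e ` X) h" "\<forall>v \<in> X. h (e v) = e' v"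
        using ex_embedding_on_if_atoms_agree[of e' X M L N e] by (auto simp: Ext_def)
      then show "\<exists>h. embedding_on L N M (e ` X) h \<and> (\<forall>v \<in> Y. h (e v) = x v)"
        using e' Y by (intro exI[of _ h]) (auto simp: Ext_def)
    next
      fix h assume h: "embedding_on L N M (e ` X) h" "\<forall>v \<in> Y. h (e v) = x v"
      then have "h \<circ> e \<in> Ext" by (auto simp: Ext_def embedding_on_def)
      then show "\<exists>e' \<in> Ext. \<forall>\<phi> \<in> atoms L X. sat N e \<phi> \<longleftrightarrow> sat M e' \<phi>"
        using embedding_on_atoms_agree[OF h(1)] by blast
    qed
    finally show ?thesis .
  qed
  ultimately show ?thesis by blast
qed

definition locally_embeds ::
  "nat list \<Rightarrow> 'b fo_struct \<Rightarrow> 'a fo_struct \<Rightarrow> ('a \<Rightarrow> 'b) \<Rightarrow> 'a set \<Rightarrow> nat \<Rightarrow> bool" where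
  "locally_embeds L N M c X q \<longleftrightarrow> (\<forall>S \<subseteq> universe N. finite S \<and> card S \<le> q \<longrightarrow>
     (\<exists>\<rho>. embedding_on L N M (c ` X \<union> S) \<rho> \<and> (\<forall>x \<in> X. \<rho> (c x) = x)))"

lemma locally_embedsE:
  assumes "locally_embeds L N M c X q" "S \<subseteq> universe N" "finite S" "card S \<le> q"
  obtains \<rho> where "embedding_on L N M (c ` X \<union> S) \<rho>" "\<And>x. x \<in> X \<Longrightarrow> \<rho> (c x) = x"
proof -
  have "\<exists>\<rho>. embedding_on L N M (c ` X \<union> S) \<rho> \<and> (\<forall>x \<in> X. \<rho> (c x) = x)"
    using assms by (simp add: locally_embeds_def)
  then show thesis using that by blast
qed

lemma locally_embeds_id: "X \<subseteq> universe M \<Longrightarrow> locally_embeds L M M id X q"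
  unfolding locally_embeds_def
  by (intro allI impI exI[of _ id]) (auto simp: embedding_on_def strong_hom_on_id)

lemma ex_embedding_on_assignment:
  assumes emb: "locally_embeds L N M c X q" and x: "x ` {..<p} = X"
    and e: "e ` {..<p + q} \<subseteq> universe N" "\<forall>i<p. e i = c (x i)"
  shows "\<exists>h. embedding_on L N M (e ` {..<p + q}) h \<and> (\<forall>i<p. h (e i) = x i)"
proof -
  have split: "{..<p + q} = {..<p} \<union> {p..<p + q}" by auto
  have "e ` {p..<p + q} \<subseteq> universe N" using e(1) by (auto simp: split)
  moreover have "card (e ` {p..<p + q}) \<le> q"
    using card_image_le[of "{p..<p + q}" e] by simp
  ultimately obtain \<rho> where
    "embedding_on L N M (c ` X \<union> e ` {p..<p + q}) \<rho>" "\<And>x. x \<in> X \<Longrightarrow> \<rho> (c x) = x"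
    using locally_embedsE[OF emb] by (metis finite_atLeastLessThan finite_imageI)
  moreover have "c ` X \<union> e ` {p..<p + q} = e ` {..<p + q}"
    unfolding split image_Un x[symmetric] using e(2) by (auto simp: image_image)
  ultimately show ?thesis using e(2) x by (intro exI[of _ \<rho>]) auto
qed

lemma locally_embeds_if_ex_embedding_on_assignments:
  assumes x: "x ` {..<p} = X" and N: "universe N \<noteq> {}" and cX: "c ` X \<subseteq> universe N"
    and emb: "\<And>e. e ` {..<p + q} \<subseteq> universe N \<Longrightarrow> \<forall>i<p. e i = c (x i) \<Longrightarrow>
      \<exists>h. embedding_on L N M (e ` {..<p + q}) h \<and> (\<forall>i<p. h (e i) = x i)"
  shows "locally_embeds L N M c X q"
  unfolding locally_embeds_def
proof (intro allI impI; elim conjE)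
  fix S assume S: "S \<subseteq> universe N" "finite S" "card S \<le> q"
  obtain f where f: "S \<subseteq> f ` {p..<p + q}" "f ` {p..<p + q} \<subseteq> universe N"
    using ex_image_superset[OF S(1) N S(2), of "{p..<p + q}"] S(3) by auto
  define e where "e i = (if i < p then c (x i) else f i)" for i
  have "{..<p + q} = {..<p} \<union> {p..<p + q}" by auto
  then have e: "e ` {..<p + q} = c ` X \<union> f ` {p..<p + q}"
    unfolding x[symmetric] by (auto simp: e_def image_Un image_image)
  then have "e ` {..<p + q} \<subseteq> universe N" using cX f(2) by simp
  then obtain h where h: "embedding_on L N M (e ` {..<p + q}) h" "\<forall>i<p. h (e i) = x i"
    using emb[of e] by (auto simp: e_def)
  have "c ` X \<union> S \<subseteq> e ` {..<p + q}" unfolding e using f(1) by (rule Un_mono[OF order_refl])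
  from embedding_on_subset[OF h(1) this] have "embedding_on L N M (c ` X \<union> S) h" .
  moreover have "h (c (x i)) = x i" if "i < p" for i
    using h(2) that by (simp add: e_def)
  ultimately show "\<exists>\<rho>. embedding_on L N M (c ` X \<union> S) \<rho> \<and> (\<forall>x \<in> X. \<rho> (c x) = x)"
    unfolding x[symmetric] by (intro exI[of _ h]) auto
qed

lemma ex_locally_embeds_iff:
  assumes x: "bij_betw x {..<p} X" and N: "universe N \<noteq> {}"
  shows "(\<exists>c. c ` X \<subseteq> universe N \<and> locally_embeds L N M c X q) \<longleftrightarrow>
    (\<exists>e. e ` {..<p} \<subseteq> universe N \<and> (\<forall>e'. e' ` {..<p + q} \<subseteq> universe N \<and> (\<forall>i<p. e' i = e i) \<longrightarrow>
      (\<exists>h. embedding_on L N M (e' ` {..<p + q}) h \<and> (\<forall>i<p. h (e' i) = x i))))"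
    (is "_ \<longleftrightarrow> (\<exists>e. _ \<and> ?all_embed e)")
proof (intro iffI; elim exE conjE)
  have X: "x ` {..<p} = X" using x by (simp add: bij_betw_def)
  {
    fix c assume c: "c ` X \<subseteq> universe N" "locally_embeds L N M c X q"
    have "?all_embed (c \<circ> x)"
      using ex_embedding_on_assignment[OF c(2) X] by simp
    then show "\<exists>e. e ` {..<p} \<subseteq> universe N \<and> ?all_embed e"
      using c(1) by (intro exI[of _ "c \<circ> x"]) (auto simp: X[symmetric])
  next
    fix e assume e: "e ` {..<p} \<subseteq> universe N" and emb: "?all_embed e"
    define c where "c = e \<circ> inv_into {..<p} x"
    have cx: "c (x i) = e i" if "i < p" for i
      using that bij_betw_inv_into_left[OF x] by (simp add: c_def)
    have "c ` X \<subseteq> universe N" using e cx by (auto simp: X[symmetric])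
    moreover from X N this have "locally_embeds L N M c X q"
      by (rule locally_embeds_if_ex_embedding_on_assignments) (use emb cx in simp)
    ultimately show "\<exists>c. c ` X \<subseteq> universe N \<and> locally_embeds L N M c X q" by blast
  }
qed

lemma ex_local_embedding_sentence:
  fixes M :: "'a fo_struct"
  assumes "finite X"
  shows "\<exists>\<theta>. bernays_schoenfinkel \<theta> \<and> closed_fm L \<theta> \<and> quantifiers \<theta> = card X + q \<and>
    (\<forall>N :: 'b fo_struct. universe N \<noteq> {} \<longrightarrow>
      (true_on N \<theta> \<longleftrightarrow> (\<exists>c. c ` X \<subseteq> universe N \<and> locally_embeds L N M c X q)))"
proof -
  define p where "p = card X"
  obtain x where x: "bij_betw x {..<p} X"
    using ex_bij_betw_nat_finite[OF assms] by (auto simp: p_def atLeast0LessThan)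
  obtain \<psi> where "qf_fm L {..<p + q} \<psi>" and sat: "\<And>(N :: 'b fo_struct) e. sat N e \<psi> \<longleftrightarrow>
      (\<exists>h. embedding_on L N M (e ` {..<p + q}) h \<and> (\<forall>i \<in> {..<p}. h (e i) = x i))"
    using ex_qf_fm_embedding[of "{..<p + q}" "{..<p}" L M x, where 'b = 'b] by fastforce
  then have \<psi>: "wf_fm L \<psi>" "fv \<psi> \<subseteq> {..<p + q}" "quantifiers \<psi> = 0" by (simp_all add: qf_fm_def)
  define \<theta> where "\<theta> = foldr Ex [0..<p] (foldr All [p..<p + q] \<psi>)"
  have "bernays_schoenfinkel \<theta>" unfolding bernays_schoenfinkel_def \<theta>_def using \<psi>(3) by blast
  moreover have "closed_fm L \<theta>"
    using \<psi>
    by (auto simp: closed_fm_def \<theta>_def fv_foldr_Ex wf_fm_foldr_Ex fv_foldr_All wf_fm_foldr_All)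
  moreover have "quantifiers \<theta> = card X + q"
    by (simp add: \<theta>_def quantifiers_foldr_Ex quantifiers_foldr_All \<psi>(3) p_def)
  moreover have "true_on N \<theta> \<longleftrightarrow> (\<exists>c. c ` X \<subseteq> universe N \<and> locally_embeds L N M c X q)"
    if "universe N \<noteq> {}" for N :: "'b fo_struct"
    unfolding \<theta>_def true_on_Ex_All[OF \<psi>(2)] sat ex_locally_embeds_iff[OF x that]
    by (simp add: Ball_def)
  ultimately show ?thesis by blast
qed

lemma BS_le: "bernays_schoenfinkel \<phi> \<Longrightarrow> identifies L \<phi> M \<Longrightarrow> BS L M \<le> quantifiers \<phi>"
  unfolding BS_def by (intro Least_le) blast

lemma BS_le_if_locally_embeds_imp_isomorphic:
  fixes M :: "'a fo_struct"
  assumes M: "fo_structure L M" "universe M \<noteq> {}" and X: "X \<subseteq> universe M"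
    and iso: "\<And>(N :: 'a fo_struct) c. fo_structure L N \<Longrightarrow> order_of N = order_of M \<Longrightarrow>
      c ` X \<subseteq> universe N \<Longrightarrow> locally_embeds L N M c X q \<Longrightarrow> isomorphic L M N"
  shows "BS L M \<le> card X + q"
proof -
  have finM: "finite (universe M)" using M(1) by (simp add: fo_structure_def)
  then have "finite X" using X finite_subset by blast
  then obtain \<theta> where \<theta>: "bernays_schoenfinkel \<theta>" "closed_fm L \<theta>" "quantifiers \<theta> = card X + q"
    and true: "\<And>N :: 'a fo_struct. universe N \<noteq> {} \<Longrightarrow>
      true_on N \<theta> \<longleftrightarrow> (\<exists>c. c ` X \<subseteq> universe N \<and> locally_embeds L N M c X q)"
    using ex_local_embedding_sentence[of X L q M, where 'b = 'a] by blast
  have "true_on M \<theta>"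
    unfolding true[OF M(2)] using X locally_embeds_id[OF X] by (intro exI[of _ id]) simp
  moreover have "isomorphic L M N"
    if N: "fo_structure L N" "order_of N = order_of M" "true_on N \<theta>" for N :: "'a fo_struct"
  proof -
    have "universe N \<noteq> {}" using N(2) M(2) finM by (auto simp: order_of_def)
    then obtain c where "c ` X \<subseteq> universe N" "locally_embeds L N M c X q"
      using true N(3) by blast
    then show ?thesis by (rule iso[OF N(1,2)])
  qed
  ultimately have "identifies L \<theta> M" using \<theta>(2) unfolding identifies_def by blast
  from BS_le[OF \<theta>(1) this] show ?thesis by (simp add: \<theta>(3))
qed

lemma BS_order_0:
  fixes M :: "'a fo_struct"
  assumes L: "vocabulary L" and M: "fo_structure L M" "order_of M = 0"
  shows "BS L M = 0"
proof -
  have empty: "universe N = {}" if "fo_structure L N" "order_of N = 0" for N :: "'a fo_struct"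
    using that by (simp add: fo_structure_def order_of_def)
  have pos: "L ! i \<noteq> 0" if "i < length L" for i
    using L nth_mem[OF that] by (auto simp: vocabulary_def)
  have "isomorphic L M N" if "fo_structure L N" "order_of N = 0" for N :: "'a fo_struct"
    using empty[OF that] empty[OF M] by (auto simp: isomorphic_def bij_betw_def dest: pos)
  then have "identifies L (Neg FF) M"
    using M by (auto simp: identifies_def closed_fm_def true_on_def)
  moreover have "bernays_schoenfinkel (Neg FF)"
    unfolding bernays_schoenfinkel_def by (intro exI[of _ "[]"] exI[of _ "Neg FF"]) simp
  ultimately show ?thesis using BS_le[of "Neg FF" L M] by simp
qed

section \<open>Types over a set of parameters\<close>

text \<open>The quantifier-free type of \<open>u\<close> over the copy \<open>c ` X\<close> of \<open>X\<close>, with \<open>None\<close> standing for \<open>u\<close>;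
  labelling by \<open>X\<close> rather than by \<open>c ` X\<close> makes types in different structures comparable.\<close>

definition qf_type_along ::
  "nat list \<Rightarrow> 'b fo_struct \<Rightarrow> ('a \<Rightarrow> 'b) \<Rightarrow> 'a set \<Rightarrow> 'b \<Rightarrow> (nat \<times> 'a option list) set" where
  "qf_type_along L N c X u = {(i, w). i < length L \<and> length w = L ! i \<and>
     set w \<subseteq> insert None (Some ` X) \<and> map (case_option u c) w \<in> rel N i}"

definition realizations ::
  "nat list \<Rightarrow> 'b fo_struct \<Rightarrow> ('a \<Rightarrow> 'b) \<Rightarrow> 'a set \<Rightarrow> (nat \<times> 'a option list) set \<Rightarrow> 'b set" where
  "realizations L N c X t = {u \<in> universe N - c ` X. qf_type_along L N c X u = t}"

lemma qf_type_along_restrict: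
  "X \<subseteq> Y \<Longrightarrow> qf_type_along L N c X u =
     {(i, w) \<in> qf_type_along L N c Y u. set w \<subseteq> insert None (Some ` X)}"
  by (auto simp: qf_type_along_def)

lemma qf_type_along_mono:
  "X \<subseteq> Y \<Longrightarrow> qf_type_along L N c Y u = qf_type_along L N c Y v \<Longrightarrow>
     qf_type_along L N c X u = qf_type_along L N c X v"
  by (simp add: qf_type_along_restrict[of X Y])

lemma qf_type_along_strong_hom_on:
  assumes h: "strong_hom_on L M N (insert u (c ` X)) h" and d: "\<And>x. x \<in> X \<Longrightarrow> h (c x) = d x"
  shows "qf_type_along L N d X (h u) = qf_type_along L M c X u"
proof -
  have "map (case_option (h u) d) w \<in> rel N i \<longleftrightarrow> map (case_option u c) w \<in> rel M i"
    if w: "i < length L" "length w = L ! i" "set w \<subseteq> insert None (Some ` X)" for i w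
  proof -
    have "h (case_option u c z) = case_option (h u) d z" if "z \<in> set w" for z
      using that w(3) d by auto
    then have "map h (map (case_option u c) w) = map (case_option (h u) d) w" by simp
    moreover have "set (map (case_option u c) w) \<subseteq> insert u (c ` X)" using w(3) by auto
    ultimately show ?thesis using strong_hom_onD[OF h w(1)] w(2) by (metis length_map)
  qed
  then show ?thesis unfolding qf_type_along_def by blast
qed

lemma strong_hom_on_if_qf_type_along_eq:
  assumes eq: "qf_type_along L M id X u = qf_type_along L N d X v"
  shows "strong_hom_on L M N (insert u X) (d(u := v))"
  unfolding strong_hom_on_def
proof (intro allI impI; elim conjE)
  fix i w assume w: "i < length L" "length w = L ! i" "set w \<subseteq> insert u X"
  define w' where "w' = map (\<lambda>x. if x = u then None else Some x) w"
  have maps: "map (case_option u id) w' = w" "map (case_option v d) w' = map (d(u := v)) w"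
    by (auto simp: w'_def intro!: map_idI)
  have "length w' = L ! i" "set w' \<subseteq> insert None (Some ` X)" using w by (auto simp: w'_def)
  then have "(i, w') \<in> qf_type_along L M id X u \<longleftrightarrow> w \<in> rel M i"
    "(i, w') \<in> qf_type_along L N d X v \<longleftrightarrow> map (d(u := v)) w \<in> rel N i"
    using w(1) unfolding qf_type_along_def by (simp_all add: maps)
  then show "w \<in> rel M i \<longleftrightarrow> map (d(u := v)) w \<in> rel N i" using eq by simp
qed

lemma embedding_on_realizations:
  assumes \<rho>: "embedding_on L N M (c ` X \<union> S) \<rho>" "\<And>x. x \<in> X \<Longrightarrow> \<rho> (c x) = x"
    and u: "u \<in> S" "u \<notin> c ` X"
  shows "\<rho> u \<in> realizations L M id X (qf_type_along L N c X u)"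
proof -
  have "\<rho> u \<notin> X"
  proof
    assume X: "\<rho> u \<in> X"
    then have "\<rho> (c (\<rho> u)) = \<rho> u" by (rule \<rho>(2))
    then have "c (\<rho> u) = u"
      using \<rho>(1) u X by (auto simp: embedding_on_def dest: inj_onD)
    with u(2) X show False by (metis imageI)
  qed
  moreover have sub: "insert u (c ` X) \<subseteq> c ` X \<union> S" using u(1) by blast
  have "strong_hom_on L N M (insert u (c ` X)) \<rho>"
    by (rule strong_hom_on_subset[OF _ sub]) (use \<rho>(1) in \<open>simp add: embedding_on_def\<close>)
  then have "qf_type_along L M id X (\<rho> u) = qf_type_along L N c X u"
    by (rule qf_type_along_strong_hom_on) (simp add: \<rho>(2))
  moreover have "\<rho> u \<in> universe M" using \<rho>(1) u(1) by (auto simp: embedding_on_def)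
  ultimately show ?thesis by (simp add: realizations_def)
qed

context
  fixes L :: "nat list" and M :: "'a fo_struct"
begin

abbreviation qf_type :: "'a set \<Rightarrow> 'a \<Rightarrow> (nat \<times> 'a option list) set" where
  "qf_type \<equiv> qf_type_along L M id"

definition qf_class :: "'a set \<Rightarrow> 'a \<Rightarrow> 'a set" where
  "qf_class X a = realizations L M id X (qf_type X a)"

definition similar :: "'a \<Rightarrow> 'a \<Rightarrow> bool" where
  "similar a b \<longleftrightarrow> strong_hom_on L M M (universe M) (transpose a b)"

definition base :: "'a set \<Rightarrow> bool" where
  "base X \<longleftrightarrow> X \<subseteq> universe M \<and> (\<forall>a \<in> universe M - X. \<forall>b \<in> qf_class X a. similar a b)"

definition type_preserving_on :: "'a set \<Rightarrow> 'a set \<Rightarrow> ('a \<Rightarrow> 'a) \<Rightarrow> bool" where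
  "type_preserving_on X S \<pi> \<longleftrightarrow> inj_on \<pi> S \<and>
     (\<forall>v \<in> S. \<pi> v = v \<or> v \<in> universe M - X \<and> \<pi> v \<in> qf_class X v)"

lemma mem_qf_class_iff:
  "b \<in> qf_class X a \<longleftrightarrow> b \<in> universe M \<and> b \<notin> X \<and> qf_type X b = qf_type X a"
  by (auto simp: qf_class_def realizations_def)

lemma qf_class_eq: "b \<in> qf_class X a \<Longrightarrow> qf_class X b = qf_class X a"
  by (simp add: qf_class_def realizations_def)

lemma qf_class_antimono: "X \<subseteq> Y \<Longrightarrow> qf_class Y a \<subseteq> qf_class X a"
  by (intro subsetI) (meson mem_qf_class_iff qf_type_along_mono subsetD)

lemma base_mono: "base X \<Longrightarrow> X \<subseteq> Y \<Longrightarrow> Y \<subseteq> universe M \<Longrightarrow> base Y"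
  unfolding base_def using qf_class_antimono[of X Y] by (meson Diff_mono order_refl subsetD)

lemma similar_imp_qf_type_eq:
  assumes "similar a b" "a \<in> universe M" "X \<subseteq> universe M" "a \<notin> X" "b \<notin> X"
  shows "qf_type X b = qf_type X a"
proof -
  have "strong_hom_on L M M (insert a (id ` X)) (transpose a b)"
    using assms(1-3) strong_hom_on_subset unfolding similar_def by fastforce
  moreover have "transpose a b x = x" if "x \<in> X" for x
    using that assms(4,5) by (auto simp: transpose_def)
  ultimately show ?thesis
    using qf_type_along_strong_hom_on[of L M M a id X "transpose a b" id] by simp
qed

lemma type_preserving_on_transpose_comp:
  assumes \<pi>: "type_preserving_on X S \<pi>" and v: "v \<in> S" "\<pi> v \<noteq> v"
  shows "type_preserving_on X S (transpose v (\<pi> v) \<circ> \<pi>)"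
proof -
  have inj: "inj_on \<pi> S" using \<pi> by (simp add: type_preserving_on_def)
  have cls: "\<pi> x = x \<or> x \<in> universe M - X \<and> \<pi> x \<in> qf_class X x" if "x \<in> S" for x
    using \<pi> that unfolding type_preserving_on_def by auto
  have "(transpose v (\<pi> v) \<circ> \<pi>) x = x \<or>
      x \<in> universe M - X \<and> (transpose v (\<pi> v) \<circ> \<pi>) x \<in> qf_class X x" if x: "x \<in> S" for x
  proof -
    consider "x = v" | "x \<noteq> v" "\<pi> x = v" | "\<pi> x \<noteq> \<pi> v" "\<pi> x \<noteq> v"
      using inj x v(1) by (auto dest: inj_onD)
    then show ?thesis
    proof cases
      case 2
      then show ?thesis using cls[OF x] cls[OF v(1)] v(2) by (simp add: mem_qf_class_iff)
    next
      case 3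
      then show ?thesis using cls[OF x] by simp
    qed simp
  qed
  moreover have "inj_on (transpose v (\<pi> v) \<circ> \<pi>) S" using inj by (simp add: comp_inj_on)
  ultimately show ?thesis unfolding type_preserving_on_def by blast
qed

lemma type_preserving_on_image_subset:
  assumes "type_preserving_on X S \<pi>" "S \<subseteq> universe M"
  shows "\<pi> ` S \<subseteq> universe M"
proof (rule image_subsetI)
  fix x assume "x \<in> S"
  then have "\<pi> x = x \<or> \<pi> x \<in> qf_class X x" "x \<in> universe M"
    using assms unfolding type_preserving_on_def by blast+
  then show "\<pi> x \<in> universe M" by (auto simp: mem_qf_class_iff)
qed

lemma type_preserving_on_base:
  assumes base: "base X" and S: "finite S" "S \<subseteq> universe M" and \<pi>: "type_preserving_on X S \<pi>"
  shows "strong_hom_on L M M S \<pi>"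
  using \<pi>
proof (induction "card {v \<in> S. \<pi> v \<noteq> v}" arbitrary: \<pi> rule: less_induct)
  case less
  show ?case
  proof (cases "\<forall>v \<in> S. \<pi> v = v")
    case True
    then show ?thesis using strong_hom_on_cong[of S \<pi> id] strong_hom_on_id by simp
  next
    case False
    then obtain v where v: "v \<in> S" "\<pi> v \<noteq> v" by blast
    \<comment> \<open>Composing with the automorphism that swaps \<open>v\<close> and \<open>\<pi> v\<close> makes \<open>v\<close> a fixed point.\<close>
    let ?\<tau> = "transpose v (\<pi> v)"
    have "inj_on \<pi> S" using less.prems by (simp add: type_preserving_on_def)
    then have "{x \<in> S. (?\<tau> \<circ> \<pi>) x \<noteq> x} \<subset> {x \<in> S. \<pi> x \<noteq> x}"
      using v by (auto simp: transpose_def dest: inj_onD)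
    then have "card {x \<in> S. (?\<tau> \<circ> \<pi>) x \<noteq> x} < card {x \<in> S. \<pi> x \<noteq> x}"
      using S(1) by (intro psubset_card_mono) auto
    then have \<tau>\<pi>: "strong_hom_on L M M S (?\<tau> \<circ> \<pi>)"
      using type_preserving_on_transpose_comp[OF less.prems v] by (rule less.hyps)
    have "similar v (\<pi> v)"
      using base less.prems v unfolding base_def type_preserving_on_def by blast
    then have "strong_hom_on L M M (universe M) ?\<tau>" by (simp add: similar_def)
    moreover have "(?\<tau> \<circ> \<pi>) ` S \<subseteq> universe M"
      using type_preserving_on_transpose_comp[OF less.prems v] S(2)
      by (rule type_preserving_on_image_subset)
    ultimately have "strong_hom_on L M M S (?\<tau> \<circ> (?\<tau> \<circ> \<pi>))"
      by (rule strong_hom_on_comp[OF \<tau>\<pi>])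
    then show ?thesis by (simp add: comp_assoc[symmetric])
  qed
qed

lemma card_realizations_le:
  assumes fin: "finite (universe M)" "finite (universe N)"
    and cards: "card (universe M - X) = card (universe N - c ` X)"
    and emb: "locally_embeds L N M c X q"
    and t: "card (realizations L M id X t) < q \<or> realizations L M id X t = universe M - X"
  shows "card (realizations L N c X t) \<le> card (realizations L M id X t)"
  using t
proof
  assume "realizations L M id X t = universe M - X"
  moreover have "card (realizations L N c X t) \<le> card (universe N - c ` X)"
    using fin by (intro card_mono) (auto simp: realizations_def)
  ultimately show ?thesis using cards by simp
next
  assume small: "card (realizations L M id X t) < q"
  show ?thesis
  proof (rule ccontr)
    assume "\<not> ?thesis"
    then have "Suc (card (realizations L M id X t)) \<le> card (realizations L N c X t)" by linarith
    then obtain S where S: "S \<subseteq> realizations L N c X t"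
      "card S = Suc (card (realizations L M id X t))" "finite S"
      by (rule obtain_subset_with_card_n)
    then have "S \<subseteq> universe N" "card S \<le> q" using small by (auto simp: realizations_def)
    then obtain \<rho> where \<rho>: "embedding_on L N M (c ` X \<union> S) \<rho>" "\<And>x. x \<in> X \<Longrightarrow> \<rho> (c x) = x"
      using locally_embedsE[OF emb _ S(3)] by metis
    have "\<rho> ` S \<subseteq> realizations L M id X t"
      using embedding_on_realizations[OF \<rho>] S(1) by (auto simp: realizations_def)
    moreover have "inj_on \<rho> S"
      using \<rho>(1) unfolding embedding_on_def by (meson Un_upper2 inj_on_subset)
    moreover have "finite (realizations L M id X t)" using fin by (simp add: realizations_def)
    ultimately have "card S \<le> card (realizations L M id X t)" by (intro card_inj_on_le)
    then show False using S(2) by simp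
  qed
qed

lemma realizations_small_or_full:
  assumes "1 \<le> q"
    and classes: "\<forall>a \<in> universe M - X. card (qf_class X a) < q \<or> qf_class X a = universe M - X"
  shows "card (realizations L M id X t) < q \<or> realizations L M id X t = universe M - X"
proof (cases "realizations L M id X t = {}")
  case True
  then show ?thesis using assms(1) by simp
next
  case False
  then obtain a where a: "a \<in> universe M - X" "qf_type X a = t" by (auto simp: realizations_def)
  then show ?thesis using bspec[OF classes a(1)] by (simp add: qf_class_def)
qed

lemma ex_type_preserving_bij:
  assumes fin: "finite (universe M)" "finite (universe N)" and ord: "order_of N = order_of M"
    and X: "X \<subseteq> universe M" and c: "c ` X \<subseteq> universe N"
    and emb: "locally_embeds L N M c X q" and q: "1 \<le> q"
    and classes: "\<forall>a \<in> universe M - X. card (qf_class X a) < q \<or> qf_class X a = universe M - X"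
  shows "\<exists>h. bij_betw h (universe M) (universe N) \<and> (\<forall>x \<in> X. h x = c x) \<and>
    (\<forall>v \<in> universe M - X. h v \<in> realizations L N c X (qf_type X v))"
proof -
  have finX: "finite X" using X fin(1) finite_subset by blast
  obtain \<rho> where "\<And>x. x \<in> X \<Longrightarrow> \<rho> (c x) = x" using locally_embedsE[OF emb, of "{}"] by auto
  then have injc: "inj_on c X" by (metis inj_on_inverseI)
  have cards: "card (universe M - X) = card (universe N - c ` X)"
    using ord X c fin finX by (simp add: order_of_def card_Diff_subset card_image[OF injc])
  have le: "card (realizations L N c X t) \<le> card (realizations L M id X t)" for t
    using fin cards emb realizations_small_or_full[OF q classes] by (rule card_realizations_le)
  have eq: "card {u \<in> universe N - c ` X. qf_type_along L N c X u = t}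
      = card {v \<in> universe M - X. qf_type X v = t}" for t
    by (rule card_fibres_eq_if_le) (use fin cards le in \<open>auto simp: realizations_def\<close>)
  obtain f where f: "bij_betw f (universe M - X) (universe N - c ` X)"
    and types: "\<forall>v \<in> universe M - X. qf_type_along L N c X (f v) = qf_type X v"
    using ex_bij_betw_if_card_fibres_eq[OF _ _ eq] fin by blast
  define h where "h v = (if v \<in> X then c v else f v)" for v
  have "bij_betw h (X \<union> (universe M - X)) (c ` X \<union> (universe N - c ` X))"
    unfolding h_def using f injc by (intro bij_betw_disjoint_Un) (auto simp: bij_betw_def)
  then have "bij_betw h (universe M) (universe N)"
    using X c by (simp add: Un_absorb1)
  moreover have "h v \<in> realizations L N c X (qf_type X v)" if "v \<in> universe M - X" for v
    using bij_betwE[OF f] types that by (auto simp: h_def realizations_def)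
  ultimately show ?thesis by (intro exI[of _ h]) (simp add: h_def)
qed

lemma type_preserving_on_embedding_comp:
  assumes \<rho>: "embedding_on L N M (c ` X \<union> h ` S) \<rho>" "\<And>x. x \<in> X \<Longrightarrow> \<rho> (c x) = x"
    and S: "S \<subseteq> universe M" and h: "inj_on h S" "\<forall>x \<in> X. h x = c x"
      "\<forall>v \<in> universe M - X. h v \<in> realizations L N c X (qf_type X v)"
  shows "type_preserving_on X S (\<rho> \<circ> h)"
  unfolding type_preserving_on_def
proof (intro conjI ballI)
  have "inj_on \<rho> (h ` S)" using \<rho>(1) by (auto simp: embedding_on_def intro: inj_on_subset)
  then show "inj_on (\<rho> \<circ> h) S" using h(1) by (rule comp_inj_on[rotated])
  fix v assume v: "v \<in> S"
  show "(\<rho> \<circ> h) v = v \<or> v \<in> universe M - X \<and> (\<rho> \<circ> h) v \<in> qf_class X v"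
  proof (cases "v \<in> X")
    case True
    then show ?thesis using h(2) \<rho>(2) by simp
  next
    case False
    then have vM: "v \<in> universe M - X" using v S by auto
    then have "h v \<notin> c ` X" "qf_type_along L N c X (h v) = qf_type X v"
      using h(3) by (auto simp: realizations_def)
    then show ?thesis
      using embedding_on_realizations[OF \<rho> imageI[OF v]] vM by (simp add: qf_class_def)
  qed
qed

lemma strong_hom_on_if_type_preserving_bij:
  assumes base: "base X" and arity: "\<forall>l \<in> set L. l \<le> q"
    and emb: "locally_embeds L N M c X q"
    and h: "bij_betw h (universe M) (universe N)" "\<forall>x \<in> X. h x = c x"
      "\<forall>v \<in> universe M - X. h v \<in> realizations L N c X (qf_type X v)"
  shows "strong_hom_on L M N (universe M) h"
  unfolding strong_hom_on_def
proof (intro allI impI; elim conjE)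
  fix i w assume w: "i < length L" "length w = L ! i" "set w \<subseteq> universe M"
  have "card (h ` set w) \<le> card (set w)" by (rule card_image_le) simp
  also have "\<dots> \<le> length w" by (rule card_length)
  also have "\<dots> \<le> q" using arity w by simp
  finally have "card (h ` set w) \<le> q" .
  moreover have "h ` set w \<subseteq> universe N" using bij_betwE[OF h(1)] w(3) by auto
  ultimately obtain \<rho>
    where \<rho>: "embedding_on L N M (c ` X \<union> h ` set w) \<rho>" "\<And>x. x \<in> X \<Longrightarrow> \<rho> (c x) = x"
    using locally_embedsE[OF emb] by (metis List.finite_set finite_imageI)
  have "inj_on h (set w)" using h(1) w(3) by (meson bij_betw_def inj_on_subset)
  then have "type_preserving_on X (set w) (\<rho> \<circ> h)"
    using type_preserving_on_embedding_comp[OF \<rho> w(3)] h(2,3) by blast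
  then have "strong_hom_on L M M (set w) (\<rho> \<circ> h)"
    using type_preserving_on_base[OF base _ w(3)] by simp
  from strong_hom_onD[OF this w(1,2)] have "w \<in> rel M i \<longleftrightarrow> map \<rho> (map h w) \<in> rel M i" by simp
  also have "\<dots> \<longleftrightarrow> map h w \<in> rel N i"
    using \<rho>(1) w(1,2) strong_hom_onD[of L N M "c ` X \<union> h ` set w" \<rho> i "map h w"]
    by (simp add: embedding_on_def)
  finally show "w \<in> rel M i \<longleftrightarrow> map h w \<in> rel N i" .
qed

lemma BS_le_if_base:
  assumes M: "fo_structure L M" "universe M \<noteq> {}" and base: "base X"
    and arity: "\<forall>l \<in> set L. l \<le> q" "1 \<le> q"
    and classes: "\<forall>a \<in> universe M - X. card (qf_class X a) < q \<or> qf_class X a = universe M - X"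
  shows "BS L M \<le> card X + q"
proof (rule BS_le_if_locally_embeds_imp_isomorphic[OF M])
  show X: "X \<subseteq> universe M" using base by (simp add: base_def)
  fix N :: "'a fo_struct" and c
  assume N: "fo_structure L N" "order_of N = order_of M" and c: "c ` X \<subseteq> universe N"
    and emb: "locally_embeds L N M c X q"
  have fin: "finite (universe M)" "finite (universe N)" using M N by (auto simp: fo_structure_def)
  obtain h where h: "bij_betw h (universe M) (universe N)" "\<forall>x \<in> X. h x = c x"
    "\<forall>v \<in> universe M - X. h v \<in> realizations L N c X (qf_type X v)"
    using ex_type_preserving_bij[OF fin N(2) X c emb arity(2) classes] by blast
  from strong_hom_on_if_type_preserving_bij[OF base arity(1) emb h] h(1)
  show "isomorphic L M N" unfolding isomorphic_iff_strong_hom_on by blast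
qed

section \<open>Small bases\<close>

lemma ex_saturated_superset:
  fixes f :: "'b set \<Rightarrow> nat"
  assumes V: "finite V" and B: "B \<subseteq> V"
  shows "\<exists>X. B \<subseteq> X \<and> X \<subseteq> V \<and> card (X - B) \<le> r * f X \<and>
    (\<forall>A \<subseteq> V. card A \<le> r \<longrightarrow> f (X \<union> A) \<le> f X)"
proof -
  define K where "K = {X. B \<subseteq> X \<and> X \<subseteq> V \<and> card (X - B) \<le> r * f X}"
  have "finite K" unfolding K_def using V by (auto intro: finite_subset[of _ "Pow V"])
  moreover have "B \<in> K" using B by (simp add: K_def)
  ultimately have K: "finite (f ` K)" "f ` K \<noteq> {}" by auto
  obtain X where X: "X \<in> K" "f X = Max (f ` K)" using Max_in[OF K] by auto
  have "f (X \<union> A) \<le> f X" if A: "A \<subseteq> V" "card A \<le> r" for A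
  proof (rule ccontr)
    assume more: "\<not> ?thesis"
    have "finite A" "finite X" using A X V finite_subset by (auto simp: K_def)
    then have "card ((X \<union> A) - B) \<le> card ((X - B) \<union> A)" by (intro card_mono) auto
    also have "\<dots> \<le> card (X - B) + card A" by (rule card_Un_le)
    also have "\<dots> \<le> r * Suc (f X)" using X(1) A(2) by (auto simp: K_def)
    also have "\<dots> \<le> r * f (X \<union> A)" using more by (intro mult_le_mono2) simp
    finally have "X \<union> A \<in> K" using X(1) A(1) by (auto simp: K_def)
    then have "f (X \<union> A) \<le> f X" unfolding X(2) using K by (intro Max_ge) auto
    with more show False by simp
  qed
  with X(1) show ?thesis unfolding K_def by blast
qed

definition type_count :: "'a set \<Rightarrow> nat" where
  "type_count X = card (qf_type X ` (universe M - X))"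

definition saturated :: "nat \<Rightarrow> 'a set \<Rightarrow> bool" where
  "saturated r X \<longleftrightarrow> (\<forall>A \<subseteq> universe M. card A \<le> r \<longrightarrow> type_count (X \<union> A) \<le> type_count X)"

definition distinguishes :: "'a \<Rightarrow> 'a \<Rightarrow> 'a list \<Rightarrow> bool" where
  "distinguishes a b w \<longleftrightarrow> set w \<subseteq> universe M \<and>
     (\<exists>i < length L. length w = L ! i \<and> (w \<in> rel M i) \<noteq> (map (transpose a b) w \<in> rel M i))"

definition partial_base :: "nat \<Rightarrow> 'a set \<Rightarrow> bool" where
  "partial_base d B \<longleftrightarrow> B \<subseteq> universe M \<and> (\<forall>a \<in> universe M - B. \<forall>b \<in> qf_class B a.
     \<forall>w. distinguishes a b w \<and> a \<in> set w \<longrightarrow> card (set w - B) \<le> d)"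

lemma similar_iff_not_distinguishes: "similar a b \<longleftrightarrow> (\<nexists>w. distinguishes a b w)"
  unfolding similar_def strong_hom_on_def distinguishes_def by blast

lemma distinguishes_commute: "distinguishes a b w \<longleftrightarrow> distinguishes b a w"
  by (simp add: distinguishes_def transpose_commute)

lemma distinguishes_meets: "distinguishes a b w \<Longrightarrow> a \<in> set w \<or> b \<in> set w"
proof (rule ccontr)
  assume "distinguishes a b w" "\<not> (a \<in> set w \<or> b \<in> set w)"
  moreover from this have "map (transpose a b) w = w"
    by (intro map_idI) (auto simp: transpose_def)
  ultimately show False by (simp add: distinguishes_def)
qed

lemma strong_hom_on_imp_not_distinguishes:
  "strong_hom_on L M M D (transpose a b) \<Longrightarrow> set w \<subseteq> D \<Longrightarrow> \<not> distinguishes a b w"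
  unfolding strong_hom_on_def distinguishes_def by blast

lemma strong_hom_on_transpose_if_qf_type_eq:
  assumes "qf_type X a = qf_type X b" "b \<notin> X"
  shows "strong_hom_on L M M (insert a X) (transpose a b)"
proof (cases "a = b")
  case True
  then show ?thesis using strong_hom_on_id by simp
next
  case False
  have "strong_hom_on L M M (insert a X) (id(a := b))"
    using assms(1) by (rule strong_hom_on_if_qf_type_along_eq)
  moreover have "(id(a := b)) x = transpose a b x" if "x \<in> insert a X" for x
    using that assms(2) False by (auto simp: transpose_def)
  ultimately show ?thesis by (rule strong_hom_on_cong[THEN iffD1, rotated])
qed

lemma strong_hom_on_transpose_via_third:
  assumes "a \<notin> X" "b \<notin> X" "c \<notin> X" and distinct: "a \<noteq> b" "c \<noteq> a" "c \<noteq> b"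
    and "qf_type (insert b X) a = qf_type (insert b X) c"
    and "qf_type (insert c X) b = qf_type (insert c X) a"
    and "qf_type (insert a X) c = qf_type (insert a X) b"
  shows "strong_hom_on L M M (insert a (insert b X)) (transpose a b)"
proof -
  \<comment> \<open>The replacements \<open>a \<mapsto> c\<close>, \<open>b \<mapsto> a\<close>, \<open>c \<mapsto> b\<close> of single elements compose to the swap.\<close>
  have ac: "strong_hom_on L M M (insert a (insert b X)) (id(a := c))"
    and ba: "strong_hom_on L M M (insert b (insert c X)) (id(b := a))"
    and cb: "strong_hom_on L M M (insert c (insert a X)) (id(c := b))"
    using assms(7-9) by (auto intro: strong_hom_on_if_qf_type_along_eq)
  have bac: "strong_hom_on L M M (insert a (insert b X)) (id(b := a) \<circ> id(a := c))"
    using assms(1) distinct by (intro strong_hom_on_comp[OF ac ba]) auto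
  have "strong_hom_on L M M (insert a (insert b X)) (id(c := b) \<circ> (id(b := a) \<circ> id(a := c)))"
    using assms(1,2) distinct by (intro strong_hom_on_comp[OF bac cb]) auto
  moreover have "(id(c := b) \<circ> (id(b := a) \<circ> id(a := c))) x = transpose a b x"
    if "x \<in> insert a (insert b X)" for x
    using that assms(1-3) distinct by (auto simp: transpose_def)
  ultimately show ?thesis by (rule strong_hom_on_cong[THEN iffD1, rotated])
qed

lemma base_if_partial_base_1:
  assumes B: "partial_base 1 B"
  shows "base B"
proof -
  have not_dist: "\<not> distinguishes a b w"
    if ab: "a \<in> universe M - B" "b \<in> qf_class B a" and aw: "a \<in> set w" for a b w
  proof
    assume dist: "distinguishes a b w"
    then have "card (set w - B) \<le> 1" using B ab aw unfolding partial_base_def by blast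
    then have "set w \<subseteq> insert a B"
      using ab(1) aw by (auto simp: card_le_Suc0_iff_eq)
    moreover have "strong_hom_on L M M (insert a B) (transpose a b)"
      using ab by (intro strong_hom_on_transpose_if_qf_type_eq) (auto simp: mem_qf_class_iff)
    ultimately show False using strong_hom_on_imp_not_distinguishes dist by blast
  qed
  have "similar a b" if ab: "a \<in> universe M - B" "b \<in> qf_class B a" for a b
  proof -
    have ba: "b \<in> universe M - B" "a \<in> qf_class B b" using ab by (auto simp: mem_qf_class_iff)
    have "\<not> distinguishes a b w" for w
      using distinguishes_meets[of a b w] not_dist[OF ab, of w] not_dist[OF ba, of w]
      by (auto simp: distinguishes_commute[of b a])
    then show ?thesis by (simp add: similar_iff_not_distinguishes)
  qed
  then show ?thesis using B unfolding base_def partial_base_def by blast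
qed

lemma partial_base_empty:
  assumes "\<forall>l \<in> set L. l \<le> d"
  shows "partial_base d {}"
proof -
  have "card (set w) \<le> d" if "i < length L" "length w = L ! i" for i and w :: "'a list"
    using card_length[of w] assms that by (metis nth_mem order_trans)
  then show ?thesis by (auto simp: partial_base_def distinguishes_def)
qed

context
  assumes finite_universe: "finite (universe M)"
begin

lemma type_count_less:
  assumes XY: "X \<subseteq> Y"
    and types: "qf_type X ` (universe M - X) \<subseteq> qf_type X ` (universe M - Y)"
    and ab: "a \<in> universe M - Y" "b \<in> universe M - Y" "qf_type X a = qf_type X b"
      "qf_type Y a \<noteq> qf_type Y b"
  shows "type_count X < type_count Y"
proof -
  define g where "g T = {(i, w) \<in> T. set w \<subseteq> insert None (Some ` X)}"
    for T :: "(nat \<times> 'a option list) set"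
  have g: "qf_type X u = g (qf_type Y u)" for u
    unfolding g_def by (rule qf_type_along_restrict[OF XY])
  let ?T = "qf_type Y ` (universe M - Y)"
  have fin: "finite ?T" using finite_universe by simp
  have "qf_type X ` (universe M - X) = qf_type X ` (universe M - Y)"
    using types XY by auto
  also have "\<dots> = g ` ?T" by (simp add: g image_image)
  finally have eq: "type_count X = card (g ` ?T)" by (simp add: type_count_def)
  have "\<not> inj_on g ?T"
    using ab g unfolding inj_on_def by (metis image_eqI)
  then have "card (g ` ?T) \<noteq> card ?T" using fin eq_card_imp_inj_on by blast
  then show ?thesis
    using card_image_le[OF fin, of g] by (simp add: eq type_count_def[of Y])
qed

lemma saturated_qf_type_eq:
  assumes X: "saturated r X" and A: "A \<subseteq> universe M" "card A \<le> r"
    and large: "\<forall>u \<in> A. r < card (qf_class X u)"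
    and ab: "a \<in> universe M - (X \<union> A)" "b \<in> universe M - (X \<union> A)" "qf_type X a = qf_type X b"
  shows "qf_type (X \<union> A) a = qf_type (X \<union> A) b"
proof (rule ccontr)
  assume neq: "qf_type (X \<union> A) a \<noteq> qf_type (X \<union> A) b"
  have "qf_type X ` (universe M - X) \<subseteq> qf_type X ` (universe M - (X \<union> A))"
  proof (rule image_subsetI)
    fix v assume v: "v \<in> universe M - X"
    have "\<not> qf_class X v \<subseteq> A"
    proof
      assume sub: "qf_class X v \<subseteq> A"
      then have "v \<in> A" using v by (auto simp: mem_qf_class_iff)
      have "card (qf_class X v) \<le> card A"
        using sub A(1) finite_universe by (intro card_mono) (auto intro: finite_subset)
      with large \<open>v \<in> A\<close> A(2) show False by fastforce
    qed
    then obtain v' where "v' \<in> qf_class X v" "v' \<notin> A" by blast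
    then show "qf_type X v \<in> qf_type X ` (universe M - (X \<union> A))"
      by (intro image_eqI[of _ _ v']) (auto simp: mem_qf_class_iff)
  qed
  from type_count_less[OF _ this ab neq] have "type_count X < type_count (X \<union> A)" by simp
  moreover have "type_count (X \<union> A) \<le> type_count X" using X A by (simp add: saturated_def)
  ultimately show False by simp
qed

lemma saturated_qf_type_insert_eq:
  assumes X: "saturated r X" and D: "D \<subseteq> universe M" "Suc (card D) \<le> r"
    and large: "\<forall>u \<in> insert a D. r < card (qf_class X u)"
    and xyz: "x \<in> qf_class X a - insert z D" "y \<in> qf_class X a - insert z D" "z \<in> qf_class X a"
  shows "qf_type (insert z (X \<union> D)) x = qf_type (insert z (X \<union> D)) y"
proof -
  have "qf_type (X \<union> insert z D) x = qf_type (X \<union> insert z D) y"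
  proof (rule saturated_qf_type_eq[OF X])
    show "insert z D \<subseteq> universe M" using D(1) xyz(3) by (simp add: mem_qf_class_iff)
    show "card (insert z D) \<le> r"
      using D finite_subset[OF D(1) finite_universe] by (simp add: card_insert_if)
    show "\<forall>u \<in> insert z D. r < card (qf_class X u)"
      using large qf_class_eq[OF xyz(3)] by simp
  qed (use xyz(1,2) in \<open>simp_all add: mem_qf_class_iff\<close>)
  then show ?thesis by simp
qed

lemma saturated_strong_hom_on_transpose_inside:
  assumes X: "saturated r X" and D: "D \<subseteq> universe M - X" "Suc (card D) \<le> r"
    and large: "\<forall>u \<in> insert a D. Suc r < card (qf_class X u)"
    and a: "a \<in> universe M - X" "a \<notin> D" and b: "b \<in> qf_class X a" "b \<notin> D" "b \<noteq> a"
  shows "strong_hom_on L M M (insert a (insert b (X \<union> D))) (transpose a b)"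
proof -
  have "finite D" using D(1) finite_universe finite_subset by blast
  then have "card (insert a (insert b D)) \<le> Suc r" using D(2) by (simp add: card_insert_if)
  also have "\<dots> < card (qf_class X a)" using large by simp
  finally have "\<not> qf_class X a \<subseteq> insert a (insert b D)"
    using \<open>finite D\<close> by (metis card_mono finite_insert leD)
  then obtain c where c: "c \<in> qf_class X a" "c \<notin> insert a (insert b D)" by blast
  have type_eq: "qf_type (insert z (X \<union> D)) x = qf_type (insert z (X \<union> D)) y"
    if "x \<in> {a, b, c} - {z}" "y \<in> {a, b, c} - {z}" "z \<in> {a, b, c}" for x y z
  proof (rule saturated_qf_type_insert_eq[OF X _ D(2)])
    show "D \<subseteq> universe M" using D(1) by blast
    show "\<forall>u \<in> insert a D. r < card (qf_class X u)" using large by auto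
    show "x \<in> qf_class X a - insert z D" "y \<in> qf_class X a - insert z D" "z \<in> qf_class X a"
      using that a b c by (auto simp: mem_qf_class_iff)
  qed
  show ?thesis
    using a b c by (intro strong_hom_on_transpose_via_third[of _ _ _ c] type_eq)
      (auto simp: mem_qf_class_iff)
qed

lemma saturated_strong_hom_on_transpose:
  assumes X: "saturated r X" and F: "F \<subseteq> universe M - X" "card F \<le> Suc r"
    and large: "\<forall>u \<in> F. Suc r < card (qf_class X u)"
    and a: "a \<in> F" and b: "b \<in> qf_class X a"
  shows "strong_hom_on L M M (X \<union> F) (transpose a b)"
proof -
  have finF: "finite F" using F(1) finite_universe finite_subset by blast
  consider "b = a" | "b \<notin> F" | "b \<in> F" "b \<noteq> a" by blast
  then show ?thesis
  proof cases
    case 1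
    then show ?thesis using strong_hom_on_id by simp
  next
    case 2
    let ?A = "F - {a}"
    have "card ?A \<le> r" using F(2) a finF by simp
    then have "qf_type (X \<union> ?A) a = qf_type (X \<union> ?A) b"
      using F(1) large a b 2 by (intro saturated_qf_type_eq[OF X]) (auto simp: mem_qf_class_iff)
    then have "strong_hom_on L M M (insert a (X \<union> ?A)) (transpose a b)"
      using b 2 by (intro strong_hom_on_transpose_if_qf_type_eq) (auto simp: mem_qf_class_iff)
    moreover have "insert a (X \<union> ?A) = X \<union> F" using a by auto
    ultimately show ?thesis by simp
  next
    case 3
    let ?D = "F - {a} - {b}"
    have F_eq: "F = insert a (insert b ?D)" "a \<notin> insert b ?D" "b \<notin> ?D" "finite ?D"
      using a 3 finF by auto
    then have "Suc (card ?D) \<le> r"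
      using F(2) by (metis Suc_le_mono card_insert_disjoint finite.insertI)
    then have "strong_hom_on L M M (insert a (insert b (X \<union> ?D))) (transpose a b)"
      using F(1) large a b 3 by (intro saturated_strong_hom_on_transpose_inside[OF X]) auto
    moreover have "insert a (insert b (X \<union> ?D)) = X \<union> F" using F_eq(1) by blast
    ultimately show ?thesis by simp
  qed
qed

lemma card_small_classes_le:
  "card {v \<in> universe M - X. card (qf_class X v) \<le> s} \<le> s * type_count X"
proof -
  let ?Y = "{v \<in> universe M - X. card (qf_class X v) \<le> s}"
  let ?T = "qf_type X ` (universe M - X)"
  have "card {v \<in> ?Y. qf_type X v = t} \<le> s" for t
  proof (cases "{v \<in> ?Y. qf_type X v = t} = {}")
    case True
    then show ?thesis by (metis card.empty le0)
  next
    case False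
    then obtain v where v: "v \<in> ?Y" "qf_type X v = t" by blast
    have "card {v \<in> ?Y. qf_type X v = t} \<le> card (qf_class X v)"
      using finite_universe v
      by (intro card_mono) (auto simp: mem_qf_class_iff qf_class_def realizations_def)
    with v show ?thesis by simp
  qed
  then have "(\<Sum>t\<in>?T. card {v \<in> ?Y. qf_type X v = t}) \<le> card ?T * s"
    using sum_bounded_above[of ?T "\<lambda>t. card {v \<in> ?Y. qf_type X v = t}" s] by simp
  moreover have
    "card (\<Union>t\<in>?T. {v \<in> ?Y. qf_type X v = t}) \<le> (\<Sum>t\<in>?T. card {v \<in> ?Y. qf_type X v = t})"
    using finite_universe by (intro card_UN_le) auto
  moreover have "(\<Union>t\<in>?T. {v \<in> ?Y. qf_type X v = t}) = ?Y" by auto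
  ultimately show ?thesis by (simp add: type_count_def mult.commute)
qed

lemma partial_base_saturated_union:
  assumes B: "partial_base (Suc r) B" and X: "B \<subseteq> X" "X \<subseteq> universe M" "saturated r X"
  shows "partial_base r (X \<union> {v \<in> universe M - X. card (qf_class X v) \<le> Suc r})"
    (is "partial_base r ?B'")
  unfolding partial_base_def
proof (intro conjI ballI allI impI; (elim conjE)?)
  show "?B' \<subseteq> universe M" using X(2) by auto
  fix a b w assume a: "a \<in> universe M - ?B'" and b: "b \<in> qf_class ?B' a"
    and dist: "distinguishes a b w" and aw: "a \<in> set w"
  show "card (set w - ?B') \<le> r"
  proof (rule ccontr)
    assume many: "\<not> ?thesis"
    have bX: "b \<in> qf_class X a" and bB: "b \<in> qf_class B a"
      using b qf_class_antimono[of X ?B' a] qf_class_antimono[of B ?B' a] X(1) by auto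
    have "a \<in> universe M - B" using a X(1) by auto
    then have few: "card (set w - B) \<le> Suc r"
      using B bB dist aw unfolding partial_base_def by blast
    then have eq: "set w - ?B' = set w - B"
      using many X(1) by (intro card_seteq) auto
    have wV: "set w \<subseteq> universe M" using dist by (simp add: distinguishes_def)
    have "strong_hom_on L M M (X \<union> (set w - ?B')) (transpose a b)"
    proof (rule saturated_strong_hom_on_transpose[OF X(3) _ _ _ _ bX])
      show "set w - ?B' \<subseteq> universe M - X" using wV by auto
      show "card (set w - ?B') \<le> Suc r" using few unfolding eq .
      show "\<forall>u \<in> set w - ?B'. Suc r < card (qf_class X u)" using wV by auto
      show "a \<in> set w - ?B'" using a aw by blast
    qed
    moreover have "set w \<subseteq> X \<union> (set w - ?B')" using eq X(1) by auto
    ultimately show False using strong_hom_on_imp_not_distinguishes dist by blast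
  qed
qed

lemma ex_partial_base_step:
  assumes B: "partial_base (Suc r) B" and m: "\<And>X. X \<subseteq> universe M \<Longrightarrow> type_count X \<le> m"
  shows "\<exists>B'. partial_base r B' \<and> card B' \<le> card B + (2 * r + 1) * m"
proof -
  have BV: "B \<subseteq> universe M" using B by (simp add: partial_base_def)
  obtain X where X: "B \<subseteq> X" "X \<subseteq> universe M" "saturated r X"
    and XB: "card (X - B) \<le> r * type_count X"
    using ex_saturated_superset[OF finite_universe BV, of r type_count]
    unfolding saturated_def by blast
  let ?Y = "{v \<in> universe M - X. card (qf_class X v) \<le> Suc r}"
  have fin: "finite B" "finite X" using BV X(2) finite_universe finite_subset by auto
  have "card (X \<union> ?Y) \<le> card X + card ?Y" by (rule card_Un_le)
  also have "card X = card B + card (X - B)"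
    using X(1) fin by (simp add: card_Diff_subset card_mono)
  also have "card ?Y \<le> Suc r * type_count X" by (rule card_small_classes_le)
  also have "card B + card (X - B) + Suc r * type_count X \<le> card B + (2 * r + 1) * type_count X"
    using XB by (simp add: algebra_simps)
  also have "\<dots> \<le> card B + (2 * r + 1) * m" using m[OF X(2)] by (intro add_left_mono mult_le_mono2)
  finally show ?thesis using partial_base_saturated_union[OF B X] by auto
qed

lemma ex_small_base:
  assumes arity: "\<forall>l \<in> set L. l \<le> k" "1 \<le> k" and m: "\<And>X. X \<subseteq> universe M \<Longrightarrow> type_count X \<le> m"
  shows "\<exists>B. base B \<and> card B + m \<le> k\<^sup>2 * m"
proof -
  have "\<exists>B. partial_base 1 B \<and> card B + 1\<^sup>2 * m \<le> k\<^sup>2 * m"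
    using arity(2)
  proof (induction rule: inc_induct)
    case base
    show ?case using partial_base_empty[OF arity(1)] by (intro exI[of _ "{}"]) auto
  next
    case (step r)
    then obtain B where "partial_base (Suc r) B" and B: "card B + (Suc r)\<^sup>2 * m \<le> k\<^sup>2 * m"
      by blast
    from ex_partial_base_step[OF this(1) m] obtain B'
      where "partial_base r B'" "card B' \<le> card B + (2 * r + 1) * m" by blast
    with B show ?case by (intro exI[of _ B']) (auto simp: power2_eq_square algebra_simps)
  qed
  then show ?thesis using base_if_partial_base_1 by auto
qed

lemma ex_transversal_base:
  assumes X: "X \<subseteq> universe M"
  shows "\<exists>B. base B \<and> card B + type_count X = card (universe M) \<and>
    (\<forall>a \<in> universe M - B. qf_class B a = {a})"
proof -
  obtain T where T: "T \<subseteq> universe M - X" "inj_on (qf_type X) T"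
    "qf_type X ` (universe M - X) = qf_type X ` T"
    using subset_image_inj[of "qf_type X ` (universe M - X)" "qf_type X" "universe M - X"] by auto
  define B where "B = universe M - T"
  have TV: "T \<subseteq> universe M" "universe M - B = T" "X \<subseteq> B" using T(1) X by (auto simp: B_def)
  have classes: "qf_class B a = {a}" if "a \<in> universe M - B" for a
  proof -
    have "b = a" if "b \<in> qf_class B a" for b
    proof -
      have "b \<in> qf_class X a" using that qf_class_antimono[OF TV(3)] by blast
      moreover have "b \<in> T" using that TV(2) by (auto simp: mem_qf_class_iff)
      ultimately show ?thesis
        using T(2) \<open>a \<in> universe M - B\<close> unfolding TV(2)
        by (auto simp: mem_qf_class_iff dest: inj_onD)
    qed
    then show ?thesis using that by (auto simp: mem_qf_class_iff)
  qed
  have "similar a a" for a using strong_hom_on_id by (simp add: similar_def)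
  then have "base B" using classes by (auto simp: base_def B_def)
  moreover have "card B + type_count X = card (universe M)"
    unfolding type_count_def T(3) card_image[OF T(2)] B_def
    using TV(1) finite_universe by (simp add: card_Diff_subset finite_subset card_mono)
  ultimately show ?thesis using classes by blast
qed

end

section \<open>The three bounds\<close>

context
  fixes k :: nat
  assumes M_structure: "fo_structure L M" and nonempty: "universe M \<noteq> {}"
    and arity: "\<forall>l \<in> set L. l \<le> k" "1 \<le> k"
begin

lemma finite_M: "finite (universe M)"
  using M_structure by (simp add: fo_structure_def)

lemma BS_le_card_add_max:
  assumes base: "base B" and s: "\<forall>a \<in> universe M - B. card (qf_class B a) \<le> s"
  shows "BS L M \<le> card B + max k (s + 1)"
proof (rule BS_le_if_base[OF M_structure nonempty base])
  show "\<forall>a \<in> universe M - B. card (qf_class B a) < max k (s + 1) \<or> qf_class B a = universe M - B"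
    using s by (auto simp: less_max_iff_disj less_Suc_eq_le)
qed (use arity in \<open>auto simp: le_max_iff_disj\<close>)

lemma BS_add_card_qf_class_le:
  assumes base: "base B" and a: "a \<in> universe M - B"
  shows "BS L M + card (qf_class B a) \<le> order_of M + k"
proof -
  let ?K = "qf_class B a"
  let ?C = "universe M - ?K"
  have K: "?K \<subseteq> universe M" "B \<subseteq> ?C"
    using base by (auto simp: base_def mem_qf_class_iff)
  have compl: "universe M - ?C = ?K" using K(1) by (simp add: double_diff)
  have "qf_class ?C b = ?K" if b: "b \<in> ?K" for b
  proof -
    have "c \<in> qf_class ?C b" if c: "c \<in> ?K" for c
    proof -
      have "b \<in> universe M - B" "c \<in> qf_class B b" using b c by (auto simp: mem_qf_class_iff)
      then have "similar b c" using base by (simp add: base_def)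
      then have "qf_type ?C c = qf_type ?C b"
        by (rule similar_imp_qf_type_eq) (use b c K in auto)
      then show ?thesis using c K(1) by (auto simp: mem_qf_class_iff)
    qed
    then show ?thesis by (auto simp: mem_qf_class_iff)
  qed
  then have "\<forall>b \<in> universe M - ?C. card (qf_class ?C b) < k \<or> qf_class ?C b = universe M - ?C"
    unfolding compl by blast
  then have "BS L M \<le> card ?C + k"
    using base_mono[OF base K(2)] by (intro BS_le_if_base[OF M_structure nonempty _ arity]) auto
  moreover have "card ?C + card ?K = order_of M"
    using K(1) finite_M
    by (simp add: order_of_def card_Diff_subset finite_subset card_mono)
  ultimately show ?thesis by simp
qed

lemma BS_add_type_count_le:
  assumes X: "X \<subseteq> universe M" and k: "2 \<le> k"
  shows "BS L M + type_count X \<le> order_of M + k"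
proof -
  obtain B where B: "base B" "card B + type_count X = order_of M"
    and classes: "\<forall>a \<in> universe M - B. qf_class B a = {a}"
    using ex_transversal_base[OF finite_M X] unfolding order_of_def by blast
  have "BS L M \<le> card B + k"
    using classes k by (intro BS_le_if_base[OF M_structure nonempty B(1) arity]) simp
  with B(2) show ?thesis by simp
qed

lemma ex_BS_bounds:
  "\<exists>b s m. BS L M \<le> b + max k (s + 1) \<and> BS L M + s \<le> order_of M + k \<and>
     (2 \<le> k \<longrightarrow> BS L M + m \<le> order_of M + k) \<and> b + m \<le> k\<^sup>2 * m"
proof -
  define m where "m = Max (type_count ` Pow (universe M))"
  have counts: "finite (type_count ` Pow (universe M))" "type_count ` Pow (universe M) \<noteq> {}"
    using finite_M by auto
  obtain X where X: "X \<subseteq> universe M" "type_count X = m"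
    using Max_in[OF counts] unfolding m_def by auto
  have "type_count X \<le> m" if "X \<subseteq> universe M" for X
    unfolding m_def using counts(1) that by (intro Max_ge) auto
  then obtain B where B: "base B" "card B + m \<le> k\<^sup>2 * m"
    using ex_small_base[OF finite_M arity] by blast
  define s where "s = Max (insert 0 ((\<lambda>a. card (qf_class B a)) ` (universe M - B)))"
  have fin: "finite (insert 0 ((\<lambda>a. card (qf_class B a)) ` (universe M - B)))"
    using finite_M by simp
  have "\<forall>a \<in> universe M - B. card (qf_class B a) \<le> s"
    unfolding s_def using fin by (auto intro: Max_ge)
  then have B_bound: "BS L M \<le> card B + max k (s + 1)" by (rule BS_le_card_add_max[OF B(1)])
  have "s = 0 \<or> (\<exists>a \<in> universe M - B. s = card (qf_class B a))"
    using Max_in[OF fin] unfolding s_def by blast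
  then have "BS L M + s \<le> order_of M + k"
  proof
    assume "s = 0"
    moreover have "card B \<le> order_of M"
      unfolding order_of_def using B(1) finite_M by (intro card_mono) (auto simp: base_def)
    ultimately show ?thesis using B_bound arity(2) by (simp add: max_def)
  qed (use BS_add_card_qf_class_le[OF B(1)] in auto)
  then show ?thesis using B_bound B(2) BS_add_type_count_le[OF X(1)] X(2) by blast
qed

end

end

lemma less_if_three_bounds:
  fixes q b s m n k :: nat
  assumes "0 < n" and k: "2 \<le> k" and bounds: "q \<le> b + max k (s + 1)" "q + s \<le> n + k"
    "q + m \<le> n + k" "b + m \<le> k\<^sup>2 * m"
  shows "real q < (1 - 1 / (2 * (real k)\<^sup>2 + 2)) * real n + real k"
proof -
  define x where "x = real n / (2 * (real k)\<^sup>2 + 2)"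
  have "2 * (real k)\<^sup>2 + 2 > 0" by (simp add: add_nonneg_pos)
  then have x: "(real k)\<^sup>2 * x = real n / 2 - x" "x > 0"
    using \<open>0 < n\<close> by (auto simp: x_def field_simps)
  have "real q < real n - x + real k"
  proof (rule ccontr)
    assume not_less: "\<not> ?thesis"
    have m: "real m \<le> x" and s: "real s \<le> x" using not_less bounds(2,3) by linarith+
    have "real b + real m \<le> (real k)\<^sup>2 * real m"
      using bounds(4) by (metis of_nat_add of_nat_le_iff of_nat_mult of_nat_power)
    moreover have "((real k)\<^sup>2 - 1) * real m \<le> ((real k)\<^sup>2 - 1) * x"
      using m k by (intro mult_left_mono) auto
    ultimately have "real b \<le> real n / 2 - 2 * x" using x(1) by (simp add: algebra_simps)
    moreover have "real q \<le> real b + max (real k) (real s + 1)"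
      using bounds(1) by (simp add: max_def split: if_splits)
    ultimately show False using not_less s x(2) k by (simp add: max_def split: if_splits)
  qed
  then show ?thesis by (simp add: x_def algebra_simps)
qed

lemma le_max_arity: "l \<in> set L \<Longrightarrow> l \<le> max_arity L"
  by (simp add: max_arity_def)

lemma max_arity_pos: "vocabulary L \<Longrightarrow> L \<noteq> [] \<Longrightarrow> 1 \<le> max_arity L"
  using Max_in[of "set L"] by (auto simp: max_arity_def vocabulary_def Suc_le_eq)

theorem theorem5p1:
  fixes L :: "nat list" and M :: "'a fo_struct" and k n :: nat
  assumes "vocabulary L" and "L \<noteq> []" and "max_arity L = k"
    and "fo_structure L M" and "order_of M = n"
  shows "real (BS L M) < (1 - 1 / (2 * (real k)\<^sup>2 + 2)) * real n + real k
    \<and> (k = 1 \<longrightarrow> real (BS L M) \<le> real n / 2 + 1)"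
proof (cases "n = 0")
  case True
  then show ?thesis
    using BS_order_0[OF assms(1,4)] max_arity_pos[OF assms(1,2)] assms(3,5) by simp
next
  case False
  then have "universe M \<noteq> {}" using assms(5) by (auto simp: order_of_def)
  moreover have arity: "\<forall>l \<in> set L. l \<le> k" "1 \<le> k"
    using le_max_arity max_arity_pos[OF assms(1,2)] assms(3) by auto
  ultimately obtain b s m where bounds: "BS L M \<le> b + max k (s + 1)" "BS L M + s \<le> n + k"
    "2 \<le> k \<Longrightarrow> BS L M + m \<le> n + k" "b + m \<le> k\<^sup>2 * m"
    using ex_BS_bounds[OF assms(4)] unfolding assms(5) by blast
  consider "k = 1" | "2 \<le> k" using arity(2) by linarith
  then show ?thesis
  proof cases
    case 1
    then have "real (BS L M) \<le> real n / 2 + 1" using bounds(1,2,4) by simp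
    then show ?thesis using 1 False by (simp add: field_simps)
  next
    case 2
    then show ?thesis
      using less_if_three_bounds[OF _ 2 bounds(1,2) _ bounds(4)] bounds(3) False by simp
  qed
qed

end
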